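(* Let $H$ and $Q$ be arbitrary groups, let $H\wr Q=H^{(Q)}\rtimes Q$ be the restricted regular wreath product, let $\pi:H\wr Q\to Q$ be the projection, and let $\iota:H\hookrightarrow H\wr Q$ be the embedding of $H$ as the coordinate of the base group indexed by $1\in Q$. Then there is a split right-exact sequence $$B_0(H)\xrightarrow{\ B_0(\iota)\ }B_0(H\wr Q)\xrightarrow{\ B_0(\pi)\ }B_0(Q)\longrightarrow0.$$ In other words, $B_0(H\wr Q)\cong B_0(Q)\oplus B_0(H)/\ker B_0(\iota)$.
   Context: The base group is $H^{(Q)}=\bigoplus_{q\in Q}H$ (restricted direct product), on which $Q$ acts by permuting coordinates regularly. For a group $G$, $M(G)=H_2(G,\mathbb Z)$, and $M_0(G)\le M(G)$ is the sum of the images of all maps $H_2(B,\mathbb Z)\to H_2(G,\mathbb Z)$ induced by inclusion, as $B$ runs through all abelian subgroups of $G$; equivalently, $M_0(G)$ is generated by the classes of $[x\mid y]-[y\mid x]$ (normalized bar complex) for commuting $x,y\in G$. The Bogomolov multiplier is $B_0(G)=M(G)/M_0(G)$, a functor of $G$. "Split right-exact" means that the sequence is exact and the surjection $B_0(\pi)$ has a right inverse homomorphism. *)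

theory Defs
  imports "HOL-Algebra.Free_Abelian_Groups"
begin

section \<open>The restricted regular wreath product\<close>

definition semidirect_product ::
  "('n, 'c) monoid_scheme \<Rightarrow> ('q, 'd) monoid_scheme \<Rightarrow> ('q \<Rightarrow> 'n \<Rightarrow> 'n) \<Rightarrow> ('n \<times> 'q) monoid"
  where "semidirect_product N Q act =
    \<lparr>carrier = carrier N \<times> carrier Q,
     monoid.mult = (\<lambda>(n, q) (m, r). (n \<otimes>\<^bsub>N\<^esub> act q m, q \<otimes>\<^bsub>Q\<^esub> r)),
     one = (\<one>\<^bsub>N\<^esub>, \<one>\<^bsub>Q\<^esub>)\<rparr>"

definition wreath_base ::
  "('h, 'c) monoid_scheme \<Rightarrow> ('q, 'd) monoid_scheme \<Rightarrow> ('q \<Rightarrow> 'h) monoid"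
  where "wreath_base H Q = sum_group (carrier Q) (\<lambda>_. H)"

text \<open>The left regular action: the entry of \<open>f\<close> at \<open>x\<close> is moved to the coordinate \<open>q x\<close>.\<close>

definition wreath_act ::
  "('q, 'd) monoid_scheme \<Rightarrow> 'q \<Rightarrow> ('q \<Rightarrow> 'h) \<Rightarrow> ('q \<Rightarrow> 'h)"
  where "wreath_act Q q f = (\<lambda>x\<in>carrier Q. f (inv\<^bsub>Q\<^esub> q \<otimes>\<^bsub>Q\<^esub> x))"

definition wreath_product ::
  "('h, 'c) monoid_scheme \<Rightarrow> ('q, 'd) monoid_scheme \<Rightarrow> (('q \<Rightarrow> 'h) \<times> 'q) monoid"
  where "wreath_product H Q = semidirect_product (wreath_base H Q) Q (wreath_act Q)"

definition wreath_proj :: "('q \<Rightarrow> 'h) \<times> 'q \<Rightarrow> 'q"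
  where "wreath_proj = snd"

definition wreath_embed ::
  "('h, 'c) monoid_scheme \<Rightarrow> ('q, 'd) monoid_scheme \<Rightarrow> 'h \<Rightarrow> ('q \<Rightarrow> 'h) \<times> 'q"
  where "wreath_embed H Q h =
    ((\<lambda>x\<in>carrier Q. if x = \<one>\<^bsub>Q\<^esub> then h else \<one>\<^bsub>H\<^esub>), \<one>\<^bsub>Q\<^esub>)"


section \<open>Second integral homology from the normalized bar complex\<close>

text \<open>
  The normalized bar complex with trivial integral coefficients, in degrees 1 to 3: the group of
  \<open>n\<close>-chains is free abelian on the symbols \<open>[x\<^sub>1|\<dots>|x\<^sub>n]\<close> with all \<open>x\<^sub>i\<close> different from the
  identity, and a symbol with some \<open>x\<^sub>i\<close> equal to the identity denotes 0.
\<close>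

definition bar_chains1 :: "('a, 'b) monoid_scheme \<Rightarrow> ('a \<Rightarrow>\<^sub>0 int) monoid"
  where "bar_chains1 G = free_Abelian_group (carrier G - {\<one>\<^bsub>G\<^esub>})"

definition bar_chains2 :: "('a, 'b) monoid_scheme \<Rightarrow> ('a \<times> 'a \<Rightarrow>\<^sub>0 int) monoid"
  where "bar_chains2 G =
    free_Abelian_group ((carrier G - {\<one>\<^bsub>G\<^esub>}) \<times> (carrier G - {\<one>\<^bsub>G\<^esub>}))"

definition bar_chains3 :: "('a, 'b) monoid_scheme \<Rightarrow> ('a \<times> 'a \<times> 'a \<Rightarrow>\<^sub>0 int) monoid"
  where "bar_chains3 G =
    free_Abelian_group ((carrier G - {\<one>\<^bsub>G\<^esub>}) \<times> (carrier G - {\<one>\<^bsub>G\<^esub>}) \<times> (carrier G - {\<one>\<^bsub>G\<^esub>}))"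

definition bar1 :: "('a, 'b) monoid_scheme \<Rightarrow> 'a \<Rightarrow> 'a \<Rightarrow>\<^sub>0 int"
  where "bar1 G x = (if x = \<one>\<^bsub>G\<^esub> then 0 else frag_of x)"

definition bar2 :: "('a, 'b) monoid_scheme \<Rightarrow> 'a \<Rightarrow> 'a \<Rightarrow> 'a \<times> 'a \<Rightarrow>\<^sub>0 int"
  where "bar2 G x y = (if x = \<one>\<^bsub>G\<^esub> \<or> y = \<one>\<^bsub>G\<^esub> then 0 else frag_of (x, y))"

definition bar_boundary2 :: "('a, 'b) monoid_scheme \<Rightarrow> ('a \<times> 'a \<Rightarrow>\<^sub>0 int) \<Rightarrow> ('a \<Rightarrow>\<^sub>0 int)"
  where "bar_boundary2 G =
    frag_extend (\<lambda>(x, y). bar1 G y - bar1 G (x \<otimes>\<^bsub>G\<^esub> y) + bar1 G x)"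

definition bar_boundary3 ::
  "('a, 'b) monoid_scheme \<Rightarrow> ('a \<times> 'a \<times> 'a \<Rightarrow>\<^sub>0 int) \<Rightarrow> ('a \<times> 'a \<Rightarrow>\<^sub>0 int)"
  where "bar_boundary3 G =
    frag_extend (\<lambda>(x, y, z).
      bar2 G y z - bar2 G (x \<otimes>\<^bsub>G\<^esub> y) z + bar2 G x (y \<otimes>\<^bsub>G\<^esub> z) - bar2 G x y)"

definition bar_cycles2 :: "('a, 'b) monoid_scheme \<Rightarrow> ('a \<times> 'a \<Rightarrow>\<^sub>0 int) monoid"
  where "bar_cycles2 G =
    (bar_chains2 G)\<lparr>carrier := kernel (bar_chains2 G) (bar_chains1 G) (bar_boundary2 G)\<rparr>"

definition bar_boundaries2 :: "('a, 'b) monoid_scheme \<Rightarrow> ('a \<times> 'a \<Rightarrow>\<^sub>0 int) set"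
  where "bar_boundaries2 G = bar_boundary3 G ` carrier (bar_chains3 G)"

definition schur_multiplier :: "('a, 'b) monoid_scheme \<Rightarrow> ('a \<times> 'a \<Rightarrow>\<^sub>0 int) set monoid"
  where "schur_multiplier G = bar_cycles2 G Mod bar_boundaries2 G"

definition bar_map2 ::
  "('b, 'd) monoid_scheme \<Rightarrow> ('a \<Rightarrow> 'b) \<Rightarrow> ('a \<times> 'a \<Rightarrow>\<^sub>0 int) \<Rightarrow> ('b \<times> 'b \<Rightarrow>\<^sub>0 int)"
  where "bar_map2 K f = frag_extend (\<lambda>(x, y). bar2 K (f x) (f y))"

text \<open>
  A homomorphism induced on quotients sends a coset \<open>C\<close> to the coset of the image of any
  representative. The union below is over equal cosets whenever the induced map is well defined.
  The source group is not a parameter because it enters only through the coset \<open>C\<close>.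
\<close>

definition quotient_map ::
  "('b, 'd) monoid_scheme \<Rightarrow> 'b set \<Rightarrow> ('a \<Rightarrow> 'b) \<Rightarrow> 'a set \<Rightarrow> 'b set"
  where "quotient_map K N f C = (\<Union>x\<in>C. N #>\<^bsub>K\<^esub> f x)"

definition schur_multiplier_map ::
  "('b, 'd) monoid_scheme \<Rightarrow> ('a \<Rightarrow> 'b) \<Rightarrow> ('a \<times> 'a \<Rightarrow>\<^sub>0 int) set \<Rightarrow> ('b \<times> 'b \<Rightarrow>\<^sub>0 int) set"
  where "schur_multiplier_map K f =
    quotient_map (bar_cycles2 K) (bar_boundaries2 K) (bar_map2 K f)"


section \<open>The Bogomolov multiplier\<close>

text \<open>The sum of a family of subgroups of an abelian group is the subgroup generated by their union.\<close>

definition schur_multiplier0 ::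
  "('a, 'b) monoid_scheme \<Rightarrow> ('a \<times> 'a \<Rightarrow>\<^sub>0 int) set set"
  where "schur_multiplier0 G =
    generate (schur_multiplier G)
      (\<Union>B \<in> {B. subgroup B G \<and> comm_group (G\<lparr>carrier := B\<rparr>)}.
        schur_multiplier_map G (\<lambda>x. x) ` carrier (schur_multiplier (G\<lparr>carrier := B\<rparr>)))"

definition bogomolov_multiplier ::
  "('a, 'b) monoid_scheme \<Rightarrow> ('a \<times> 'a \<Rightarrow>\<^sub>0 int) set set monoid"
  where "bogomolov_multiplier G = schur_multiplier G Mod schur_multiplier0 G"

definition bogomolov_multiplier_map ::
  "('b, 'd) monoid_scheme \<Rightarrow> ('a \<Rightarrow> 'b) \<Rightarrow>
    ('a \<times> 'a \<Rightarrow>\<^sub>0 int) set set \<Rightarrow> ('b \<times> 'b \<Rightarrow>\<^sub>0 int) set set"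
  where "bogomolov_multiplier_map K f =
    quotient_map (schur_multiplier K) (schur_multiplier0 K) (schur_multiplier_map K f)"


section \<open>Split right-exact sequences\<close>

text \<open>
  \<open>A \<rightarrow> B \<rightarrow> C \<rightarrow> 0\<close> is exact and the second map has a right inverse homomorphism. The library's
  \<open>exact_seq\<close> needs all groups to have the same element type, so it does not apply here.
\<close>

definition split_right_exact ::
  "('a, 'd) monoid_scheme \<Rightarrow> ('b, 'e) monoid_scheme \<Rightarrow> ('c, 'f) monoid_scheme \<Rightarrow>
    ('a \<Rightarrow> 'b) \<Rightarrow> ('b \<Rightarrow> 'c) \<Rightarrow> bool"
  where "split_right_exact A B C f g \<longleftrightarrow>
    group_hom A B f \<and> group_hom B C g \<and>
    f ` carrier A = kernel B C g \<and>
    g ` carrier B = carrier C \<and>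
    (\<exists>s \<in> hom C B. \<forall>x \<in> carrier C. g (s x) = x)"

end

theory Submission
  imports Defs
begin

text \<open>
  Let \<open>W\<close> be the wreath product and let \<open>K\<close> be the group of 2-cycles of \<open>W\<close> whose class in the Bogomolov
  multiplier is trivial. Modulo \<open>K\<close> the symbol \<open>[w|v]\<close> is a 2-cocycle which is symmetric on commuting
  pairs, so in the corresponding central extension \<open>E\<close> of \<open>W\<close> commuting elements have commuting
  lifts. Conjugates of lifts of \<open>H\<close> by lifts of elements \<open>x \<noteq> y\<close> of \<open>Q\<close> therefore commute in \<open>E\<close>, and
  \<open>(n, q)\<close> has the lift \<open>(\<Prod>\<^sub>x b\<^sub>x a(n\<^sub>x) b\<^sub>x\<^sup>-\<^sup>1) b\<^sub>q\<close>, where \<open>a\<close> and \<open>b\<close> are the standard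
  lifts of \<open>H\<close> and \<open>Q\<close>. Multiplying two such lifts shows that, up to a coboundary,
  \<open>[(n, q)|(m, r)]\<close> equals \<open>[q|r]\<close> plus the sum over \<open>x\<close> of the images of
  \<open>[n\<^sub>x|m\<^sub>y]\<close> with \<open>y = q\<^sup>-\<^sup>1 x\<close>. Hence every 2-cycle of \<open>W\<close> is, modulo \<open>K\<close>, the sum of the image of a
  2-cycle of \<open>H\<close> and the image of its projection to \<open>Q\<close>.
\<close>

section \<open>Quotients and split sequences\<close>

text \<open>Because \<open>f\<close> sends \<open>M\<close> into \<open>N\<close>, every
  representative of the coset of \<open>a\<close> gives the same coset of \<open>N\<close>. The
  union in \<open>quotient_map\<close> thus runs over a constant family, which is nonempty because
  \<open>M\<close> contains the identity.\<close>

lemma quotient_map_coset: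
  assumes "group A" "group B" and f: "f \<in> hom A B" and M: "M \<lhd> A" and N: "N \<lhd> B"
    and sub: "f ` M \<subseteq> N" and a: "a \<in> carrier A"
  shows "quotient_map B N f (M #>\<^bsub>A\<^esub> a) = N #>\<^bsub>B\<^esub> f a"
proof -
  interpret A: group A by fact
  interpret B: group B by fact
  interpret M: normal M A by fact
  interpret N: normal N B by fact
  have "N #>\<^bsub>B\<^esub> f (m \<otimes>\<^bsub>A\<^esub> a) = N #>\<^bsub>B\<^esub> f a" if m: "m \<in> M" for m
  proof -
    have mN: "f m \<in> N" using m sub by auto
    have "N #>\<^bsub>B\<^esub> f (m \<otimes>\<^bsub>A\<^esub> a) = (N #>\<^bsub>B\<^esub> f m) #>\<^bsub>B\<^esub> f a"
      using B.coset_mult_assoc[OF N.subset] hom_mult[OF f M.mem_carrier[OF m] a]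
        N.mem_carrier[OF mN] hom_in_carrier[OF f a] by simp
    also have "N #>\<^bsub>B\<^esub> f m = N"
      using B.coset_join2[OF N.mem_carrier[OF mN] N.subgroup_axioms mN] .
    finally show ?thesis .
  qed
  then have "quotient_map B N f (M #>\<^bsub>A\<^esub> a) = (\<Union>m\<in>M. N #>\<^bsub>B\<^esub> f a)"
    by (auto simp: quotient_map_def r_coset_def)
  then show ?thesis using M.one_closed by blast
qed

lemma quotient_map_hom:
  assumes "group A" "group B" and f: "f \<in> hom A B" and M: "M \<lhd> A" and N: "N \<lhd> B"
    and sub: "f ` M \<subseteq> N"
  shows "quotient_map B N f \<in> hom (A Mod M) (B Mod N)"
proof (rule homI)
  interpret A: group A by fact
  interpret B: group B by fact
  interpret M: normal M A by fact
  interpret N: normal N B by fact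
  note coset = quotient_map_coset[OF assms]
  show "quotient_map B N f C \<in> carrier (B Mod N)" if "C \<in> carrier (A Mod M)" for C
    using that hom_in_carrier[OF f] by (auto simp: carrier_FactGroup coset)
  show "quotient_map B N f (C \<otimes>\<^bsub>A Mod M\<^esub> D)
      = quotient_map B N f C \<otimes>\<^bsub>B Mod N\<^esub> quotient_map B N f D"
    if "C \<in> carrier (A Mod M)" "D \<in> carrier (A Mod M)" for C D
    using that hom_in_carrier[OF f] hom_mult[OF f]
    by (auto simp: carrier_FactGroup coset M.rcos_sum N.rcos_sum)
qed

text \<open>The section \<open>s\<close> decomposes the abelian group \<open>B\<close> internally as
  \<open>s(C)\<close> times the kernel of \<open>g\<close>. By exactness that kernel is the image of
  \<open>f\<close>, hence a copy of \<open>A\<close> modulo the kernel of \<open>f\<close>.\<close>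

lemma split_right_exact_iso:
  assumes ex: "split_right_exact A B C f g" and B: "comm_group B"
  shows "B \<cong> C \<times>\<times> (A Mod kernel A B f)"
proof -
  interpret B: comm_group B by fact
  interpret f: group_hom A B f using ex by (simp add: split_right_exact_def)
  interpret g: group_hom B C g using ex by (simp add: split_right_exact_def)
  have img: "f ` carrier A = kernel B C g" using ex by (simp add: split_right_exact_def)
  obtain s where s: "s \<in> hom C B" and gs: "\<And>x. x \<in> carrier C \<Longrightarrow> g (s x) = x"
    using ex by (auto simp: split_right_exact_def)
  interpret s: group_hom C B s by unfold_locales (rule s)
  let ?K = "B\<lparr>carrier := kernel B C g\<rparr>"
  have K: "subgroup (kernel B C g) B" by (rule g.subgroup_kernel)
  have Kgrp: "group ?K" using K by (rule B.subgroup_imp_group)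
  \<comment> \<open>Exactness turns \<open>f\<close> into a surjection onto the kernel of
    \<open>g\<close>, to which the first isomorphism theorem applies.\<close>
  have fK: "group_hom A ?K f"
    using f.homh img Kgrp
    by (auto simp: group_hom_def group_hom_axioms_def hom_def)
  have "A Mod kernel A B f \<cong> ?K"
    using group_hom.FactGroup_iso[OF fK] img by (simp add: kernel_def)
  then have 1: "C \<times>\<times> (A Mod kernel A B f) \<cong> C \<times>\<times> ?K"
    by (intro g.H.DirProd_iso_trans) auto
  have "(\<lambda>(c, k). s c \<otimes>\<^bsub>B\<^esub> k) \<in> iso (C \<times>\<times> ?K) B"
    unfolding iso_iff
  proof (intro conjI)
    have kB: "k \<in> carrier B" if "k \<in> kernel B C g" for k using that by (simp add: kernel_def)
    show "(\<lambda>(c, k). s c \<otimes>\<^bsub>B\<^esub> k) \<in> hom (C \<times>\<times> ?K) B"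
      by (rule homI) (auto simp: kB B.m_ac)
    show "inj_on (\<lambda>(c, k). s c \<otimes>\<^bsub>B\<^esub> k) (carrier (C \<times>\<times> ?K))"
    proof (rule inj_onI; clarsimp)
      fix c k c' k' assume c: "c \<in> carrier C" "c' \<in> carrier C"
        and k: "k \<in> kernel B C g" "k' \<in> kernel B C g" and eq: "s c \<otimes>\<^bsub>B\<^esub> k = s c' \<otimes>\<^bsub>B\<^esub> k'"
      have "g (s c \<otimes>\<^bsub>B\<^esub> k) = c" "g (s c' \<otimes>\<^bsub>B\<^esub> k') = c'"
        using c k by (simp_all add: kernel_def gs)
      then have "c = c'" using eq by simp
      then show "c = c' \<and> k = k'" using eq c k kB by simp
    qed
    show "(\<lambda>(c, k). s c \<otimes>\<^bsub>B\<^esub> k) ` carrier (C \<times>\<times> ?K) = carrier B"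
    proof (intro equalityI subsetI)
      fix b assume b: "b \<in> carrier B"
      \<comment> \<open>Dividing \<open>b\<close> by \<open>s (g b)\<close> removes its image under
        \<open>g\<close> and leaves the kernel component.\<close>
      let ?k = "inv\<^bsub>B\<^esub> s (g b) \<otimes>\<^bsub>B\<^esub> b"
      have "?k \<in> kernel B C g" using b by (simp add: kernel_def gs)
      moreover have "b = s (g b) \<otimes>\<^bsub>B\<^esub> ?k" using b by (simp add: B.m_assoc[symmetric])
      ultimately show "b \<in> (\<lambda>(c, k). s c \<otimes>\<^bsub>B\<^esub> k) ` carrier (C \<times>\<times> ?K)"
        using b by (intro image_eqI[where x = "(g b, ?k)"]) auto
    qed (auto simp: kB)
  qed
  then have "C \<times>\<times> ?K \<cong> B" by (rule is_isoI)
  then have "C \<times>\<times> (A Mod kernel A B f) \<cong> B" using 1 iso_trans by blast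
  then show ?thesis
    using group.iso_sym DirProd_group[OF g.H.group_axioms f.normal_kernel[THEN normal.factorgroup_is_group]]
    by blast
qed

section \<open>The normalized bar complex\<close>

lemma carrier_bar_chains2: "z \<in> carrier (bar_chains2 G) \<longleftrightarrow>
    Poly_Mapping.keys z \<subseteq> (carrier G - {\<one>\<^bsub>G\<^esub>}) \<times> (carrier G - {\<one>\<^bsub>G\<^esub>})"
  by (simp add: bar_chains2_def)

lemma bar_chains2_simps [simp]:
  "x \<otimes>\<^bsub>bar_chains2 G\<^esub> y = x + y" "\<one>\<^bsub>bar_chains2 G\<^esub> = 0"
  by (simp_all add: bar_chains2_def)

lemma comm_group_bar_chains2: "comm_group (bar_chains2 G)"
  by (simp add: bar_chains2_def abelian_free_Abelian_group)

lemma bar_chains2_diff: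
  assumes "a \<in> carrier (bar_chains2 G)" "b \<in> carrier (bar_chains2 G)"
  shows "a - b \<in> carrier (bar_chains2 G)"
  using assms keys_diff[of a b] by (auto simp: carrier_bar_chains2)

lemma bar2_in_chains: "x \<in> carrier G \<Longrightarrow> y \<in> carrier G \<Longrightarrow> bar2 G x y \<in> carrier (bar_chains2 G)"
  by (simp add: carrier_bar_chains2 bar2_def)

lemma bar1_in_chains: "x \<in> carrier G \<Longrightarrow> bar1 G x \<in> carrier (bar_chains1 G)"
  by (simp add: bar_chains1_def bar1_def)

lemma frag_extend_in_free_Abelian_group:
  assumes "Poly_Mapping.keys c \<subseteq> S" "\<And>x. x \<in> S \<Longrightarrow> f x \<in> carrier (free_Abelian_group T)"
  shows "frag_extend f c \<in> carrier (free_Abelian_group T)"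
  using assms keys_frag_extend[of f c] by fastforce

lemma bar_boundary2_diff: "bar_boundary2 G (a - b) = bar_boundary2 G a - bar_boundary2 G b"
  by (simp add: bar_boundary2_def frag_extend_diff)

lemma bar_boundary2_add: "bar_boundary2 G (a + b) = bar_boundary2 G a + bar_boundary2 G b"
  by (simp add: bar_boundary2_def frag_extend_add)

lemma bar_map2_diff: "bar_map2 K f (a - b) = bar_map2 K f a - bar_map2 K f b"
  by (simp add: bar_map2_def frag_extend_diff)

lemma bar_map2_add: "bar_map2 K f (a + b) = bar_map2 K f a + bar_map2 K f b"
  by (simp add: bar_map2_def frag_extend_add)

lemma bar_chains2_sum:
  assumes "\<And>i. i \<in> I \<Longrightarrow> f i \<in> carrier (bar_chains2 G)"
  shows "sum f I \<in> carrier (bar_chains2 G)"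
  unfolding bar_chains2_def
  by (rule sum_closed_free_Abelian_group) (use assms in \<open>simp add: bar_chains2_def\<close>)

lemma bar_boundary2_sum: "finite I \<Longrightarrow> bar_boundary2 G (sum f I) = (\<Sum>i\<in>I. bar_boundary2 G (f i))"
  by (simp add: bar_boundary2_def frag_extend_sum)

lemma bar_map2_sum: "finite I \<Longrightarrow> bar_map2 G f (sum g I) = (\<Sum>i\<in>I. bar_map2 G f (g i))"
  by (simp add: bar_map2_def frag_extend_sum)

text \<open>The generator case ranges over all pairs, with degenerate symbols equal to zero.
  Formulas stated for \<open>bar2\<close> can then be proved uniformly, even when a product or an
  image of a nontrivial element becomes trivial.\<close>

lemma bar_chains2_induct [consumes 1, case_names zero bar2 diff]:
  assumes z: "z \<in> carrier (bar_chains2 G)" and 0: "P 0"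
    and bar2: "\<And>x y. x \<in> carrier G \<Longrightarrow> y \<in> carrier G \<Longrightarrow> P (bar2 G x y)"
    and diff: "\<And>a b. a \<in> carrier (bar_chains2 G) \<Longrightarrow> b \<in> carrier (bar_chains2 G) \<Longrightarrow> P a \<Longrightarrow> P b \<Longrightarrow> P (a - b)"
  shows "P z"
proof -
  have "Poly_Mapping.keys z \<subseteq> (carrier G - {\<one>\<^bsub>G\<^esub>}) \<times> (carrier G - {\<one>\<^bsub>G\<^esub>})"
    using z by (simp add: carrier_bar_chains2)
  then show ?thesis
  proof (rule free_Abelian_group_induct)
    fix a assume "a \<in> (carrier G - {\<one>\<^bsub>G\<^esub>}) \<times> (carrier G - {\<one>\<^bsub>G\<^esub>})"
    then show "P (frag_of a)" using bar2[of "fst a" "snd a"] by (cases a) (simp add: bar2_def)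
  qed (use 0 diff in \<open>auto simp: carrier_bar_chains2\<close>)
qed

lemma bar_map2_id: "z \<in> carrier (bar_chains2 G) \<Longrightarrow> bar_map2 G (\<lambda>x. x) z = z"
  by (induction z rule: bar_chains2_induct)
    (auto simp: bar_map2_diff bar2_def, auto simp: bar_map2_def bar2_def)

text \<open>Degenerate symbols are covered too: a homomorphism preserves the identity, so both sides
  vanish there.\<close>

lemma bar_map2_bar2:
  assumes "group G" "group K" "f \<in> hom G K"
  shows "bar_map2 K f (bar2 G x y) = bar2 K (f x) (f y)"
  using hom_one[OF assms(3,1,2)] by (auto simp: bar_map2_def bar2_def)

lemma bar_map2_in_chains:
  assumes "group G" "group K" "f \<in> hom G K" "z \<in> carrier (bar_chains2 G)"
  shows "bar_map2 K f z \<in> carrier (bar_chains2 K)"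
  using assms(4)
proof (induction z rule: bar_chains2_induct)
  case zero
  then show ?case by (simp add: bar_map2_def carrier_bar_chains2)
next
  case (bar2 x y)
  then show ?case
    by (simp add: bar_map2_bar2[OF assms(1-3)] bar2_in_chains hom_in_carrier[OF assms(3)])
qed (simp add: bar_map2_diff bar_chains2_diff)

lemma bar_map2_compose:
  assumes "group G" "group K" "group L" "f \<in> hom G K" "g \<in> hom K L" "z \<in> carrier (bar_chains2 G)"
  shows "bar_map2 L g (bar_map2 K f z) = bar_map2 L (g \<circ> f) z"
  using assms(6)
proof (induction z rule: bar_chains2_induct)
  case (bar2 x y)
  then show ?case
    using bar_map2_bar2[OF assms(1,2,4)] bar_map2_bar2[OF assms(2,3,5)]
      bar_map2_bar2[OF assms(1,3) hom_compose[OF assms(4,5)]] by (simp add: comp_def)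
qed (simp_all add: bar_map2_diff, simp add: bar_map2_def)

text \<open>If \<open>x\<close> or \<open>y\<close> is the identity, the right side cancels to zero,
  so the formula for nondegenerate symbols persists.\<close>

lemma bar_boundary2_bar2:
  fixes G :: "('a, 'b) monoid_scheme" (structure)
  assumes "group G" "x \<in> carrier G" "y \<in> carrier G"
  shows "bar_boundary2 G (bar2 G x y) = bar1 G y - bar1 G (x \<otimes>\<^bsub>G\<^esub> y) + bar1 G x"
proof -
  interpret group G by fact
  show ?thesis using assms by (auto simp: bar_boundary2_def bar2_def bar1_def)
qed

lemma bar_boundary2_in_chains:
  fixes G :: "('a, 'b) monoid_scheme" (structure)
  assumes "group G" "z \<in> carrier (bar_chains2 G)"
  shows "bar_boundary2 G z \<in> carrier (bar_chains1 G)"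
proof -
  interpret group G by fact
  show ?thesis
    unfolding bar_boundary2_def bar_chains1_def
  proof (rule frag_extend_in_free_Abelian_group)
    show "Poly_Mapping.keys z \<subseteq> (carrier G - {\<one>}) \<times> (carrier G - {\<one>})"
      using assms(2) by (simp add: carrier_bar_chains2)
    fix p assume "p \<in> (carrier G - {\<one>}) \<times> (carrier G - {\<one>})"
    then obtain x y where p: "p = (x, y)" "x \<in> carrier G" "y \<in> carrier G" by auto
    show "(case p of (x, y) \<Rightarrow> bar1 G y - bar1 G (x \<otimes> y) + bar1 G x) \<in>
       carrier (free_Abelian_group (carrier G - {\<one>}))"
      using p bar1_in_chains[of x G] bar1_in_chains[of y G] bar1_in_chains[of "x \<otimes> y" G]
        keys_add[of "bar1 G y - bar1 G (x \<otimes> y)" "bar1 G x"] keys_diff[of "bar1 G y" "bar1 G (x \<otimes> y)"]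
      by (fastforce simp: bar_chains1_def)
  qed
qed

lemma bar_boundary2_hom:
  assumes "group G"
  shows "bar_boundary2 G \<in> hom (bar_chains2 G) (bar_chains1 G)"
  using bar_boundary2_in_chains[OF assms]
  by (intro homI) (auto simp: bar_boundary2_add, simp add: bar_chains1_def)

lemma carrier_bar_cycles2: "z \<in> carrier (bar_cycles2 G) \<longleftrightarrow>
    z \<in> carrier (bar_chains2 G) \<and> bar_boundary2 G z = 0"
  by (simp add: bar_cycles2_def kernel_def bar_chains1_def)

lemma bar_cycles2_simps [simp]:
  "x \<otimes>\<^bsub>bar_cycles2 G\<^esub> y = x + y" "\<one>\<^bsub>bar_cycles2 G\<^esub> = 0"
  by (simp_all add: bar_cycles2_def)

lemma subgroup_bar_cycles2:
  assumes "group G"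
  shows "subgroup (carrier (bar_cycles2 G)) (bar_chains2 G)"
proof -
  have "group_hom (bar_chains2 G) (bar_chains1 G) (bar_boundary2 G)"
    using assms bar_boundary2_hom comm_group_bar_chains2[of G] comm_group.axioms(2)
    by (auto simp: group_hom_def group_hom_axioms_def bar_chains1_def)
  from group_hom.subgroup_kernel[OF this] show ?thesis by (simp add: bar_cycles2_def)
qed

lemma comm_group_bar_cycles2:
  assumes "group G"
  shows "comm_group (bar_cycles2 G)"
proof -
  have *: "bar_cycles2 G = (bar_chains2 G)\<lparr>carrier := carrier (bar_cycles2 G)\<rparr>"
    by (simp add: bar_cycles2_def)
  show ?thesis
    by (subst *, rule group.group_comm_groupI)
      (use comm_group.axioms(2)[OF comm_group_bar_chains2]
        group.subgroup_imp_group[OF _ subgroup_bar_cycles2[OF assms]] in \<open>auto simp: add.commute\<close>)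
qed

text \<open>The boundary of \<open>[x|y|z]\<close>, indexed by group elements instead of a chain, so
  that it is available for degenerate symbols. There its terms cancel to zero.\<close>

definition bar3_boundary :: "('a, 'b) monoid_scheme \<Rightarrow> 'a \<Rightarrow> 'a \<Rightarrow> 'a \<Rightarrow> ('a \<times> 'a \<Rightarrow>\<^sub>0 int)"
  where "bar3_boundary G x y z =
    bar2 G y z - bar2 G (x \<otimes>\<^bsub>G\<^esub> y) z + bar2 G x (y \<otimes>\<^bsub>G\<^esub> z) - bar2 G x y"

lemma bar_boundary3_diff: "bar_boundary3 G (a - b) = bar_boundary3 G a - bar_boundary3 G b"
  by (simp add: bar_boundary3_def frag_extend_diff)

lemma bar_boundaries2_diff:
  assumes "a \<in> bar_boundaries2 G" "b \<in> bar_boundaries2 G"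
  shows "a - b \<in> bar_boundaries2 G"
proof -
  obtain u v where "a = bar_boundary3 G u" "b = bar_boundary3 G v"
    "u \<in> carrier (bar_chains3 G)" "v \<in> carrier (bar_chains3 G)"
    using assms by (auto simp: bar_boundaries2_def)
  moreover from this have "u - v \<in> carrier (bar_chains3 G)"
    using keys_diff[of u v] by (auto simp: bar_chains3_def)
  ultimately show ?thesis
    unfolding bar_boundaries2_def by (metis bar_boundary3_diff image_eqI)
qed

lemma bar3_boundary_in_boundaries:
  fixes G :: "('a, 'b) monoid_scheme" (structure)
  assumes "group G" "x \<in> carrier G" "y \<in> carrier G" "z \<in> carrier G"
  shows "bar3_boundary G x y z \<in> bar_boundaries2 G"
proof -
  interpret group G by fact
  show ?thesis
  proof (cases "x = \<one> \<or> y = \<one> \<or> z = \<one>")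
    case True
    then have "bar3_boundary G x y z = 0" using assms by (auto simp: bar3_boundary_def bar2_def)
    also have "0 = bar_boundary3 G 0" by (simp add: bar_boundary3_def)
    finally show ?thesis by (auto simp: bar_boundaries2_def bar_chains3_def)
  next
    case False
    then have "bar3_boundary G x y z = bar_boundary3 G (frag_of (x, y, z))"
      by (simp add: bar_boundary3_def bar3_boundary_def)
    then show ?thesis using False assms
      by (auto simp: bar_boundaries2_def bar_chains3_def intro!: image_eqI)
  qed
qed

lemma bar_boundaries2_induct [consumes 1, case_names zero bar3 diff]:
  assumes z: "z \<in> bar_boundaries2 G" and 0: "P 0"
    and bar3: "\<And>x y z. x \<in> carrier G \<Longrightarrow> y \<in> carrier G \<Longrightarrow> z \<in> carrier G \<Longrightarrow> P (bar3_boundary G x y z)"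
    and diff: "\<And>a b. P a \<Longrightarrow> P b \<Longrightarrow> P (a - b)"
  shows "P z"
proof -
  obtain u where u: "z = bar_boundary3 G u"
    "Poly_Mapping.keys u \<subseteq> (carrier G - {\<one>\<^bsub>G\<^esub>}) \<times> (carrier G - {\<one>\<^bsub>G\<^esub>}) \<times> (carrier G - {\<one>\<^bsub>G\<^esub>})"
    using z by (auto simp: bar_boundaries2_def bar_chains3_def)
  from u(2) have "P (bar_boundary3 G u)"
  proof (rule free_Abelian_group_induct)
    fix a assume "a \<in> (carrier G - {\<one>\<^bsub>G\<^esub>}) \<times> (carrier G - {\<one>\<^bsub>G\<^esub>}) \<times> (carrier G - {\<one>\<^bsub>G\<^esub>})"
    then show "P (bar_boundary3 G (frag_of a))"
      using bar3 by (auto simp: bar_boundary3_def bar3_boundary_def)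
  qed (use 0 diff in \<open>auto simp: bar_boundary3_diff, simp add: bar_boundary3_def\<close>)
  then show ?thesis using u by simp
qed

text \<open>This is the relation that two successive boundary maps compose to zero. On generators it
  reduces to associativity.\<close>

lemma bar_boundaries2_cycles:
  fixes G :: "('a, 'b) monoid_scheme" (structure)
  assumes "group G"
  shows "bar_boundaries2 G \<subseteq> carrier (bar_cycles2 G)"
proof
  interpret group G by fact
  fix z assume "z \<in> bar_boundaries2 G"
  then show "z \<in> carrier (bar_cycles2 G)"
  proof (induction z rule: bar_boundaries2_induct)
    case zero
    show ?case by (simp add: carrier_bar_cycles2 carrier_bar_chains2 bar_boundary2_def)
  next
    case (bar3 x y z)
    \<comment> \<open>Regrouped as a difference of differences, so that closure of the chains under
      subtraction applies.\<close>
    have "bar3_boundary G x y z = (bar2 G y z - bar2 G (x \<otimes> y) z) - (bar2 G x y - bar2 G x (y \<otimes> z))"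
      by (simp add: bar3_boundary_def)
    then show ?case
      using bar3 by (simp add: carrier_bar_cycles2 bar_chains2_diff bar2_in_chains
          bar_boundary2_diff bar_boundary2_bar2[OF assms] m_assoc)
  next
    case (diff a b)
    then show ?case by (simp add: carrier_bar_cycles2 bar_chains2_diff bar_boundary2_diff)
  qed
qed

text \<open>The one-step subgroup test in additive notation: \<open>0\<close> is
  \<open>a - a\<close>, a negative is \<open>0 - a\<close>, and a sum is
  \<open>a - (- b)\<close>.\<close>

lemma subgroup_diffI:
  assumes "S \<subseteq> carrier (bar_cycles2 G)" "group G" "S \<noteq> {}" "\<And>a b. a \<in> S \<Longrightarrow> b \<in> S \<Longrightarrow> a - b \<in> S"
  shows "subgroup S (bar_cycles2 G)"
proof -
  interpret C: comm_group "bar_cycles2 G" using assms(2) by (rule comm_group_bar_cycles2)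
  have 0: "0 \<in> S" using assms(3,4) by (metis ex_in_conv cancel_comm_monoid_add_class.diff_cancel)
  have neg: "- a \<in> S" if "a \<in> S" for a using assms(4)[OF 0 that] by simp
  have "inv\<^bsub>bar_cycles2 G\<^esub> a = - a" if "a \<in> S" for a
    using that assms(1) neg[OF that] by (intro C.inv_equality) auto
  moreover have "a + b \<in> S" if "a \<in> S" "b \<in> S" for a b
    using assms(4)[OF that(1) neg[OF that(2)]] by simp
  ultimately show ?thesis using assms(1,3) neg
    by (intro C.subgroupI) auto
qed

lemma normal_bar_boundaries2:
  assumes "group G"
  shows "bar_boundaries2 G \<lhd> bar_cycles2 G"
proof -
  interpret C: comm_group "bar_cycles2 G" using assms by (rule comm_group_bar_cycles2)
  have "bar_boundary3 G 0 \<in> bar_boundaries2 G"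
    by (auto simp: bar_boundaries2_def bar_chains3_def)
  then have "subgroup (bar_boundaries2 G) (bar_cycles2 G)"
    by (intro subgroup_diffI bar_boundaries2_cycles assms bar_boundaries2_diff) auto
  then show ?thesis by (rule C.subgroup_imp_normal)
qed

lemma comm_group_schur_multiplier:
  assumes "group G"
  shows "comm_group (schur_multiplier G)"
  unfolding schur_multiplier_def
  by (intro comm_group.abelian_FactGroup comm_group_bar_cycles2
      normal_imp_subgroup normal_bar_boundaries2 assms)

section \<open>Functoriality\<close>

text \<open>The chain map property between degrees 2 and 1. The map on 1-chains uses
  \<open>bar1 K\<close>, which kills the generators that \<open>f\<close> sends to the
  identity.\<close>

lemma bar_boundary2_bar_map2:
  assumes "group G" "group K" "f \<in> hom G K" "z \<in> carrier (bar_chains2 G)"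
  shows "bar_boundary2 K (bar_map2 K f z) = frag_extend (\<lambda>x. bar1 K (f x)) (bar_boundary2 G z)"
  using assms(4)
proof (induction z rule: bar_chains2_induct)
  case zero
  then show ?case by (simp add: bar_map2_def bar_boundary2_def)
next
  case (bar2 x y)
  have "frag_extend (\<lambda>x. bar1 K (f x)) (bar1 G u) = bar1 K (f u)" for u
    using hom_one[OF assms(3,1,2)] by (simp add: bar1_def)
  then show ?case
    using bar2 by (simp add: bar_map2_bar2[OF assms(1-3)] bar_boundary2_bar2[OF assms(1)]
      bar_boundary2_bar2[OF assms(2)] hom_in_carrier[OF assms(3)] hom_mult[OF assms(3)]
      frag_extend_add frag_extend_diff)
qed (simp add: bar_map2_diff bar_boundary2_diff frag_extend_diff)

lemma bar_map2_in_cycles: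
  assumes "group G" "group K" "f \<in> hom G K" "z \<in> carrier (bar_cycles2 G)"
  shows "bar_map2 K f z \<in> carrier (bar_cycles2 K)"
  using assms bar_map2_in_chains[OF assms(1-3)] bar_boundary2_bar_map2[OF assms(1-3)]
  by (simp add: carrier_bar_cycles2)

lemma bar_map2_hom:
  assumes "group G" "group K" "f \<in> hom G K"
  shows "bar_map2 K f \<in> hom (bar_cycles2 G) (bar_cycles2 K)"
  using bar_map2_in_cycles[OF assms] by (intro homI) (auto simp: bar_map2_add)

lemma bar_map2_boundaries:
  assumes "group G" "group K" "f \<in> hom G K"
  shows "bar_map2 K f ` bar_boundaries2 G \<subseteq> bar_boundaries2 K"
proof clarify
  interpret G: group G by fact
  fix z assume "z \<in> bar_boundaries2 G"
  then show "bar_map2 K f z \<in> bar_boundaries2 K"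
  proof (induction z rule: bar_boundaries2_induct)
    case zero
    show ?case using normal_bar_boundaries2[OF assms(2)]
      by (metis bar_cycles2_simps(2) bar_map2_def frag_extend_0 normal_imp_subgroup subgroup.one_closed)
  next
    case (bar3 x y z)
    have "bar_map2 K f (bar3_boundary G x y z) = bar3_boundary K (f x) (f y) (f z)"
      using bar3 by (simp add: bar3_boundary_def bar_map2_diff bar_map2_add bar_map2_bar2[OF assms]
          hom_mult[OF assms(3)])
    then show ?case
      using bar3_boundary_in_boundaries[OF assms(2)] bar3 hom_in_carrier[OF assms(3)] by simp
  qed (simp add: bar_map2_diff bar_boundaries2_diff)
qed

section \<open>Classes of cycles in the Schur multiplier and the subgroup coming from abelian
  subgroups\<close>

definition schur_class :: "('a, 'b) monoid_scheme \<Rightarrow> ('a \<times> 'a \<Rightarrow>\<^sub>0 int) \<Rightarrow> ('a \<times> 'a \<Rightarrow>\<^sub>0 int) set"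
  where "schur_class G z = bar_boundaries2 G #>\<^bsub>bar_cycles2 G\<^esub> z"

lemma carrier_schur_multiplier:
  "carrier (schur_multiplier G) = schur_class G ` carrier (bar_cycles2 G)"
  by (simp add: schur_multiplier_def carrier_FactGroup schur_class_def)

lemma schur_class_hom:
  assumes "group G"
  shows "schur_class G \<in> hom (bar_cycles2 G) (schur_multiplier G)"
  using normal.r_coset_hom_Mod[OF normal_bar_boundaries2[OF assms]]
  by (simp add: schur_multiplier_def schur_class_def[abs_def])

lemma schur_multiplier_map_class:
  assumes "group G" "group K" "f \<in> hom G K" "z \<in> carrier (bar_cycles2 G)"
  shows "schur_multiplier_map K f (schur_class G z) = schur_class K (bar_map2 K f z)"
  unfolding schur_multiplier_map_def schur_class_def
  by (rule quotient_map_coset) (simp_all add: assms comm_group_bar_cycles2 comm_group.axioms(2)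
      bar_map2_hom normal_bar_boundaries2 bar_map2_boundaries)

lemma schur_multiplier_map_hom:
  assumes "group G" "group K" "f \<in> hom G K"
  shows "schur_multiplier_map K f \<in> hom (schur_multiplier G) (schur_multiplier K)"
  unfolding schur_multiplier_map_def schur_multiplier_def
  by (rule quotient_map_hom) (simp_all add: assms comm_group_bar_cycles2 comm_group.axioms(2)
      bar_map2_hom normal_bar_boundaries2 bar_map2_boundaries)

text \<open>The generating set of \<open>schur_multiplier0\<close>, named separately so that
  functoriality can be checked on generators.\<close>

definition abelian_classes :: "('a, 'b) monoid_scheme \<Rightarrow> ('a \<times> 'a \<Rightarrow>\<^sub>0 int) set set"
  where "abelian_classes G = (\<Union>B \<in> {B. subgroup B G \<and> comm_group (G\<lparr>carrier := B\<rparr>)}.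
        schur_multiplier_map G (\<lambda>x. x) ` carrier (schur_multiplier (G\<lparr>carrier := B\<rparr>)))"

lemma inclusion_hom: "group G \<Longrightarrow> subgroup B G \<Longrightarrow> (\<lambda>x. x) \<in> hom (G\<lparr>carrier := B\<rparr>) G"
  by (auto simp: hom_def dest: subgroup.mem_carrier)

lemma abelian_classes_iff:
  assumes "group G"
  shows "c \<in> abelian_classes G \<longleftrightarrow>
    (\<exists>B z. subgroup B G \<and> comm_group (G\<lparr>carrier := B\<rparr>) \<and> z \<in> carrier (bar_cycles2 (G\<lparr>carrier := B\<rparr>))
      \<and> c = schur_class G (bar_map2 G (\<lambda>x. x) z))"
proof -
  have "schur_multiplier_map G (\<lambda>x. x) (schur_class (G\<lparr>carrier := B\<rparr>) z)
      = schur_class G (bar_map2 G (\<lambda>x. x) z)"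
    if "subgroup B G" "z \<in> carrier (bar_cycles2 (G\<lparr>carrier := B\<rparr>))" for B z
    using that assms by (intro schur_multiplier_map_class inclusion_hom group.subgroup_imp_group)
  then show ?thesis
    by (auto simp: abelian_classes_def carrier_schur_multiplier) blast+
qed

lemma abelian_classes_subset:
  assumes "group G"
  shows "abelian_classes G \<subseteq> carrier (schur_multiplier G)"
  using assms
  by (auto simp: abelian_classes_iff carrier_schur_multiplier
      intro!: imageI bar_map2_in_cycles[OF _ _ inclusion_hom] group.subgroup_imp_group)

lemma schur_multiplier0_eq: "schur_multiplier0 G = generate (schur_multiplier G) (abelian_classes G)"
  by (simp add: schur_multiplier0_def abelian_classes_def)

lemma normal_schur_multiplier0:
  assumes "group G"
  shows "schur_multiplier0 G \<lhd> schur_multiplier G"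
proof -
  interpret comm_group "schur_multiplier G" using assms by (rule comm_group_schur_multiplier)
  show ?thesis
    unfolding schur_multiplier0_eq
    by (intro subgroup_imp_normal generate_is_subgroup abelian_classes_subset assms)
qed

text \<open>The image of an abelian subgroup \<open>B\<close> is abelian, and \<open>f\<close> after
  the inclusion of \<open>B\<close> equals the inclusion of \<open>f\<close>
  B\<open>after the restriction of\<close>f\<open>. Hence a class coming from\<close>B\<open>is sent to a class coming from\<close>f
  \<open>B\<close>.\<close>

lemma schur_multiplier_map_abelian_classes:
  assumes "group G" "group K" "f \<in> hom G K"
  shows "schur_multiplier_map K f ` abelian_classes G \<subseteq> abelian_classes K"
proof clarify
  interpret f: group_hom G K f using assms by (simp add: group_hom_def group_hom_axioms_def)
  fix c assume "c \<in> abelian_classes G"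
  then obtain B z where B: "subgroup B G" "comm_group (G\<lparr>carrier := B\<rparr>)"
    and z: "z \<in> carrier (bar_cycles2 (G\<lparr>carrier := B\<rparr>))"
    and c: "c = schur_class G (bar_map2 G (\<lambda>x. x) z)"
    by (auto simp: abelian_classes_iff assms)
  let ?GB = "G\<lparr>carrier := B\<rparr>" and ?KB = "K\<lparr>carrier := f ` B\<rparr>"
  interpret GB: comm_group ?GB by fact
  have sub: "subgroup (f ` B) K" using B(1) by (rule f.subgroup_img_is_subgroup)
  then interpret KB: group ?KB by (rule f.H.subgroup_imp_group)
  have mem: "\<And>x. x \<in> B \<Longrightarrow> x \<in> carrier G" using B(1) by (rule subgroup.mem_carrier)
  have comm: "comm_group ?KB"
  proof (rule KB.group_comm_groupI; clarsimp)
    fix x y assume xy: "x \<in> B" "y \<in> B"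
    then have "x \<otimes>\<^bsub>G\<^esub> y = y \<otimes>\<^bsub>G\<^esub> x" using GB.m_comm[of x y] by simp
    then show "f x \<otimes>\<^bsub>K\<^esub> f y = f y \<otimes>\<^bsub>K\<^esub> f x" using xy mem by (metis f.hom_mult)
  qed
  have fB: "f \<in> hom ?GB ?KB" by (rule homI) (auto simp: mem)
  have zc: "z \<in> carrier (bar_chains2 ?GB)" using z by (simp add: carrier_bar_cycles2)
  have "schur_multiplier_map K f c = schur_class K (bar_map2 K f (bar_map2 G (\<lambda>x. x) z))"
    unfolding c using z
    by (intro schur_multiplier_map_class assms bar_map2_in_cycles[OF GB.group_axioms] inclusion_hom B(1))
  also have "bar_map2 K f (bar_map2 G (\<lambda>x. x) z) = bar_map2 K (f \<circ> (\<lambda>x. x)) z"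
    by (rule bar_map2_compose[OF GB.group_axioms assms(1,2) inclusion_hom[OF assms(1) B(1)] assms(3) zc])
  also have "\<dots> = bar_map2 K ((\<lambda>x. x) \<circ> f) z" by (simp add: comp_def)
  also have "\<dots> = bar_map2 K (\<lambda>x. x) (bar_map2 ?KB f z)"
    by (rule bar_map2_compose[symmetric, OF GB.group_axioms KB.group_axioms assms(2) fB inclusion_hom[OF assms(2) sub] zc])
  finally show "schur_multiplier_map K f c \<in> abelian_classes K"
    using sub comm bar_map2_in_cycles[OF GB.group_axioms KB.group_axioms fB z]
    by (auto simp: abelian_classes_iff assms)
qed

text \<open>A homomorphism takes the subgroup generated by a set to the subgroup generated by its
  image, so the inclusion for \<open>abelian_classes\<close> suffices.\<close>

lemma schur_multiplier_map_schur_multiplier0: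
  assumes "group G" "group K" "f \<in> hom G K"
  shows "schur_multiplier_map K f ` schur_multiplier0 G \<subseteq> schur_multiplier0 K"
proof -
  interpret G: comm_group "schur_multiplier G" using assms(1) by (rule comm_group_schur_multiplier)
  interpret K: comm_group "schur_multiplier K" using assms(2) by (rule comm_group_schur_multiplier)
  interpret group_hom "schur_multiplier G" "schur_multiplier K" "schur_multiplier_map K f"
    by unfold_locales (rule schur_multiplier_map_hom[OF assms])
  show ?thesis
    unfolding schur_multiplier0_eq generate_img[OF abelian_classes_subset[OF assms(1)], symmetric]
    by (rule K.mono_generate[OF schur_multiplier_map_abelian_classes[OF assms]])
qed

section \<open>Classes of cycles in the Bogomolov multiplier and its functoriality\<close>

definition bogomolov_class ::
  "('a, 'b) monoid_scheme \<Rightarrow> ('a \<times> 'a \<Rightarrow>\<^sub>0 int) \<Rightarrow> ('a \<times> 'a \<Rightarrow>\<^sub>0 int) set set"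
  where "bogomolov_class G z = schur_multiplier0 G #>\<^bsub>schur_multiplier G\<^esub> schur_class G z"

lemma carrier_bogomolov_multiplier:
  "carrier (bogomolov_multiplier G) = bogomolov_class G ` carrier (bar_cycles2 G)"
  by (simp add: bogomolov_multiplier_def carrier_FactGroup bogomolov_class_def
      carrier_schur_multiplier image_image)

lemma comm_group_bogomolov_multiplier:
  assumes "group G"
  shows "comm_group (bogomolov_multiplier G)"
  unfolding bogomolov_multiplier_def
  by (intro comm_group.abelian_FactGroup comm_group_schur_multiplier
      normal_imp_subgroup normal_schur_multiplier0 assms)

lemma bogomolov_class_hom:
  assumes "group G"
  shows "bogomolov_class G \<in> hom (bar_cycles2 G) (bogomolov_multiplier G)"
proof -
  have "(\<lambda>c. schur_multiplier0 G #>\<^bsub>schur_multiplier G\<^esub> c) \<circ> schur_class G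
      \<in> hom (bar_cycles2 G) (bogomolov_multiplier G)"
    using hom_compose[OF schur_class_hom normal.r_coset_hom_Mod[OF normal_schur_multiplier0]] assms
    by (simp add: bogomolov_multiplier_def)
  then show ?thesis by (simp add: bogomolov_class_def[abs_def] comp_def)
qed

lemma group_hom_bogomolov_class:
  "group G \<Longrightarrow> group_hom (bar_cycles2 G) (bogomolov_multiplier G) (bogomolov_class G)"
  by (simp add: group_hom_def group_hom_axioms_def bogomolov_class_hom
      comm_group_bogomolov_multiplier comm_group_bar_cycles2 comm_group.axioms(2))

lemma bogomolov_multiplier_map_class:
  assumes "group G" "group K" "f \<in> hom G K" "z \<in> carrier (bar_cycles2 G)"
  shows "bogomolov_multiplier_map K f (bogomolov_class G z) = bogomolov_class K (bar_map2 K f z)"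
proof -
  have "bogomolov_multiplier_map K f (bogomolov_class G z)
      = schur_multiplier0 K #>\<^bsub>schur_multiplier K\<^esub> schur_multiplier_map K f (schur_class G z)"
    unfolding bogomolov_multiplier_map_def bogomolov_class_def
    by (rule quotient_map_coset) (simp_all add: assms comm_group_schur_multiplier comm_group.axioms(2)
      schur_multiplier_map_hom normal_schur_multiplier0 schur_multiplier_map_schur_multiplier0
      carrier_schur_multiplier)
  then show ?thesis
    by (simp add: bogomolov_class_def schur_multiplier_map_class[OF assms])
qed

lemma group_hom_bogomolov_multiplier_map:
  assumes "group G" "group K" "f \<in> hom G K"
  shows "group_hom (bogomolov_multiplier G) (bogomolov_multiplier K) (bogomolov_multiplier_map K f)"
proof -
  have "bogomolov_multiplier_map K f \<in> hom (bogomolov_multiplier G) (bogomolov_multiplier K)"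
    unfolding bogomolov_multiplier_map_def bogomolov_multiplier_def
    by (rule quotient_map_hom) (simp_all add: assms comm_group_schur_multiplier comm_group.axioms(2)
      schur_multiplier_map_hom normal_schur_multiplier0 schur_multiplier_map_schur_multiplier0)
  then show ?thesis
    by (simp add: group_hom_def group_hom_axioms_def assms
      comm_group_bogomolov_multiplier comm_group.axioms(2))
qed

text \<open>Commuting elements generate an abelian subgroup \<open>B\<close>, and the cycle
  \<open>[x|y] - [y|x]\<close> already lives in the bar complex of \<open>B\<close>.\<close>

lemma bogomolov_class_commutator_eq_one:
  fixes G :: "('a, 'b) monoid_scheme" (structure)
  assumes "group G" and xy: "x \<in> carrier G" "y \<in> carrier G" "x \<otimes>\<^bsub>G\<^esub> y = y \<otimes>\<^bsub>G\<^esub> x"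
  shows "bar2 G x y - bar2 G y x \<in> carrier (bar_cycles2 G)"
    and "bogomolov_class G (bar2 G x y - bar2 G y x) = \<one>\<^bsub>bogomolov_multiplier G\<^esub>"
proof -
  interpret group G by fact
  show cyc: "bar2 G x y - bar2 G y x \<in> carrier (bar_cycles2 G)"
    using xy by (simp add: carrier_bar_cycles2 bar_chains2_diff bar2_in_chains bar_boundary2_diff
        bar_boundary2_bar2[OF assms(1)])
  \<comment> \<open>\<open>C S\<close> is the centralizer of \<open>S\<close> in the group.\<close>
  define C where "C = (\<lambda>S. {g \<in> carrier G. \<forall>s\<in>S. g \<otimes> s = s \<otimes> g})"
  have C: "subgroup (C S) G" if "S \<subseteq> carrier G" for S
  proof (rule subgroupI)
    fix g assume g: "g \<in> C S"
    have "inv g \<otimes> s = s \<otimes> inv g" if s: "s \<in> S" for s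
    proof -
      have sg: "s \<in> carrier G" "g \<in> carrier G" "g \<otimes> s = s \<otimes> g"
        using s g \<open>S \<subseteq> carrier G\<close> by (auto simp: C_def)
      then show ?thesis by (metis inv_closed inv_solve_left inv_solve_right m_assoc m_closed)
    qed
    then show "inv g \<in> C S" using g by (auto simp: C_def)
  next
    fix g h assume "g \<in> C S" "h \<in> C S"
    then show "g \<otimes> h \<in> C S" using that by (simp add: C_def subset_iff) (metis m_assoc)
  next
    have "\<one> \<in> C S" using that by (auto simp: C_def)
    then show "C S \<noteq> {}" by auto
  qed (auto simp: C_def)
  define B where "B = generate G {x, y}"
  have Bsub: "subgroup B G" unfolding B_def using xy by (intro generate_is_subgroup) auto
  have xyB: "x \<in> B" "y \<in> B" by (auto simp: B_def generate.incl)
  \<comment> \<open>Two rounds of centralizers show that \<open>B\<close> is abelian: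
    \<open>B\<close> centralizes its generators, so the generators lie in the centralizer of
    \<open>B\<close>, and therefore so does all of \<open>B\<close>.\<close>
  have "B \<subseteq> C {x, y}" unfolding B_def using xy
    by (intro generate_subgroup_incl C) (auto simp: C_def)
  then have xyC: "{x, y} \<subseteq> C B" using xy by (auto simp: C_def)
  then have BC: "B \<subseteq> C B"
    using generate_subgroup_incl[OF xyC C[OF subgroup.subset[OF Bsub]]] by (simp add: B_def)
  interpret B: group "G\<lparr>carrier := B\<rparr>" using Bsub by (rule subgroup_imp_group)
  have comm: "comm_group (G\<lparr>carrier := B\<rparr>)"
    by (rule B.group_comm_groupI) (use BC in \<open>auto simp: C_def\<close>)
  let ?GB = "G\<lparr>carrier := B\<rparr>" let ?z = "bar2 ?GB x y - bar2 ?GB y x"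
  have "?z \<in> carrier (bar_cycles2 ?GB)"
    using xy xyB by (simp add: carrier_bar_cycles2 bar_chains2_diff bar2_in_chains bar_boundary2_diff
        bar_boundary2_bar2[OF B.group_axioms])
  moreover have "bar_map2 G (\<lambda>x. x) ?z = bar2 G x y - bar2 G y x"
    by (simp add: bar_map2_diff bar_map2_bar2[OF B.group_axioms assms(1) inclusion_hom[OF assms(1) Bsub]])
  ultimately have "schur_class G (bar2 G x y - bar2 G y x) \<in> abelian_classes G"
    using Bsub comm by (auto simp: abelian_classes_iff assms(1) intro!: exI)
  then have "schur_class G (bar2 G x y - bar2 G y x) \<in> schur_multiplier0 G"
    by (simp add: schur_multiplier0_eq generate.incl)
  then show "bogomolov_class G (bar2 G x y - bar2 G y x) = \<one>\<^bsub>bogomolov_multiplier G\<^esub>"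
    unfolding bogomolov_class_def bogomolov_multiplier_def one_FactGroup
    using normal_imp_subgroup[OF normal_schur_multiplier0[OF assms(1)]]
      comm_group_schur_multiplier[OF assms(1), THEN comm_group.axioms(2)]
    by (intro group.coset_join2) (auto dest: subgroup.mem_carrier)
qed

lemma bogomolov_class_boundary_eq_one:
  assumes "group G" "z \<in> bar_boundaries2 G"
  shows "bogomolov_class G z = \<one>\<^bsub>bogomolov_multiplier G\<^esub>"
proof -
  interpret C: comm_group "bar_cycles2 G" using assms(1) by (rule comm_group_bar_cycles2)
  interpret M: comm_group "schur_multiplier G" using assms(1) by (rule comm_group_schur_multiplier)
  have "schur_class G z = bar_boundaries2 G"
    unfolding schur_class_def
    using assms normal_imp_subgroup[OF normal_bar_boundaries2[OF assms(1)]] bar_boundaries2_cycles[OF assms(1)]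
    by (intro C.coset_join2) auto
  also have "\<dots> = \<one>\<^bsub>schur_multiplier G\<^esub>" by (simp add: schur_multiplier_def)
  finally show ?thesis
    using normal.axioms(1)[OF normal_schur_multiplier0[OF assms(1)]]
    by (simp add: bogomolov_class_def bogomolov_multiplier_def M.coset_mult_one subgroup.subset)
qed

section \<open>Wreath products and lifts to central extensions\<close>

lemma (in group) inv_mult_cancel: "x \<in> carrier G \<Longrightarrow> y \<in> carrier G \<Longrightarrow> inv x \<otimes> (x \<otimes> y) = y"
  by (simp add: m_assoc[symmetric])

section \<open>The group structure of the wreath product, its coordinate subgroups and its
  complement\<close>

locale wreath_groups = H: group H + Q: group Q
  for H :: "('h, 'c) monoid_scheme" and Q :: "('q, 'd) monoid_scheme"
begin

abbreviation N where "N \<equiv> wreath_base H Q"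
abbreviation W where "W \<equiv> wreath_product H Q"

definition supp :: "('q \<Rightarrow> 'h) \<Rightarrow> 'q set"
  where "supp n = {x \<in> carrier Q. n x \<noteq> \<one>\<^bsub>H\<^esub>}"

lemma N_iff: "n \<in> carrier N \<longleftrightarrow> n \<in> carrier Q \<rightarrow>\<^sub>E carrier H \<and> finite (supp n)"
  by (simp add: wreath_base_def carrier_sum_group supp_def)

lemma N_app: "n \<in> carrier N \<Longrightarrow> x \<in> carrier Q \<Longrightarrow> n x \<in> carrier H"
  by (auto simp: N_iff)

lemma finite_supp: "n \<in> carrier N \<Longrightarrow> finite (supp n)"
  by (simp add: N_iff)

lemma supp_subset: "supp n \<subseteq> carrier Q"
  by (auto simp: supp_def)

lemma N_mult: "n \<otimes>\<^bsub>N\<^esub> m = (\<lambda>x\<in>carrier Q. n x \<otimes>\<^bsub>H\<^esub> m x)"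
  and N_one: "\<one>\<^bsub>N\<^esub> = (\<lambda>x\<in>carrier Q. \<one>\<^bsub>H\<^esub>)"
  by (simp_all add: wreath_base_def)

sublocale N: group N
  by (simp add: wreath_base_def)

lemma N_ext:
  assumes "n \<in> carrier N" "m \<in> carrier N" "\<And>x. x \<in> carrier Q \<Longrightarrow> n x = m x"
  shows "n = m"
  using assms by (auto simp: N_iff intro: PiE_ext)

lemma act_app: "x \<in> carrier Q \<Longrightarrow> wreath_act Q q n x = n (inv\<^bsub>Q\<^esub> q \<otimes>\<^bsub>Q\<^esub> x)"
  by (simp add: wreath_act_def)

text \<open>The action only translates supports. This keeps them finite in \<open>act_closed\<close>
  and later matches the index sets when \<open>b q\<close> is moved past a product of lifts.\<close>

lemma supp_act:
  assumes "q \<in> carrier Q"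
  shows "supp (wreath_act Q q n) = (\<lambda>x. q \<otimes>\<^bsub>Q\<^esub> x) ` supp n"
proof (intro equalityI subsetI)
  fix x assume "x \<in> supp (wreath_act Q q n)"
  then show "x \<in> (\<lambda>x. q \<otimes>\<^bsub>Q\<^esub> x) ` supp n"
    using assms by (intro image_eqI[where x = "inv\<^bsub>Q\<^esub> q \<otimes>\<^bsub>Q\<^esub> x"])
      (auto simp: supp_def act_app Q.m_assoc[symmetric])
qed (use assms in \<open>auto simp: supp_def act_app Q.m_assoc[symmetric]\<close>)

lemma act_closed: "q \<in> carrier Q \<Longrightarrow> n \<in> carrier N \<Longrightarrow> wreath_act Q q n \<in> carrier N"
  unfolding N_iff by (subst supp_act) (auto simp: wreath_act_def)

lemma act_mult:
  "q \<in> carrier Q \<Longrightarrow> n \<in> carrier N \<Longrightarrow> m \<in> carrier N \<Longrightarrow>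
    wreath_act Q q (n \<otimes>\<^bsub>N\<^esub> m) = wreath_act Q q n \<otimes>\<^bsub>N\<^esub> wreath_act Q q m"
  by (auto simp: wreath_act_def N_mult restrict_def)

lemma act_act:
  "q \<in> carrier Q \<Longrightarrow> r \<in> carrier Q \<Longrightarrow>
    wreath_act Q q (wreath_act Q r n) = wreath_act Q (q \<otimes>\<^bsub>Q\<^esub> r) n"
  by (auto simp: wreath_act_def restrict_def Q.inv_mult_group Q.m_assoc)

lemma act_one: "n \<in> carrier N \<Longrightarrow> wreath_act Q \<one>\<^bsub>Q\<^esub> n = n"
  by (rule N_ext) (auto simp: act_closed act_app)

lemma act_N_one: "q \<in> carrier Q \<Longrightarrow> wreath_act Q q \<one>\<^bsub>N\<^esub> = \<one>\<^bsub>N\<^esub>"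
  by (rule N_ext) (auto simp: act_closed act_app N_one[symmetric], simp_all add: N_one)

lemma W_iff: "(n, q) \<in> carrier W \<longleftrightarrow> n \<in> carrier N \<and> q \<in> carrier Q"
  and W_mult: "(n, q) \<otimes>\<^bsub>W\<^esub> (m, r) = (n \<otimes>\<^bsub>N\<^esub> wreath_act Q q m, q \<otimes>\<^bsub>Q\<^esub> r)"
  and W_one: "\<one>\<^bsub>W\<^esub> = (\<one>\<^bsub>N\<^esub>, \<one>\<^bsub>Q\<^esub>)"
  by (simp_all add: wreath_product_def semidirect_product_def)

lemma group_W: "group W"
proof (rule groupI)
  fix w assume "w \<in> carrier W"
  then obtain n q where w: "w = (n, q)" "n \<in> carrier N" "q \<in> carrier Q"
    by (cases w) (auto simp: W_iff)
  have "(wreath_act Q (inv\<^bsub>Q\<^esub> q) (inv\<^bsub>N\<^esub> n), inv\<^bsub>Q\<^esub> q) \<otimes>\<^bsub>W\<^esub> w = \<one>\<^bsub>W\<^esub>"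
    using w by (simp add: W_mult W_one act_mult[symmetric] act_N_one)
  then show "\<exists>v\<in>carrier W. v \<otimes>\<^bsub>W\<^esub> w = \<one>\<^bsub>W\<^esub>"
    using w by (intro bexI[where x = "(wreath_act Q (inv\<^bsub>Q\<^esub> q) (inv\<^bsub>N\<^esub> n), inv\<^bsub>Q\<^esub> q)"])
      (auto simp: W_iff act_closed)
qed (auto simp: W_iff W_mult W_one act_closed act_mult act_act act_one N.m_assoc Q.m_assoc)

sublocale W: group W
  by (rule group_W)

definition coord :: "'q \<Rightarrow> 'h \<Rightarrow> ('q \<Rightarrow> 'h)"
  where "coord x h = (\<lambda>y\<in>carrier Q. if y = x then h else \<one>\<^bsub>H\<^esub>)"

lemma coord_closed:
  assumes "h \<in> carrier H"
  shows "coord x h \<in> carrier N"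
proof -
  have "supp (coord x h) \<subseteq> {x}" by (auto simp: supp_def coord_def)
  then show ?thesis using assms finite_subset[of "supp (coord x h)" "{x}"]
    by (auto simp: N_iff coord_def)
qed

lemma wreath_embed_eq: "wreath_embed H Q h = (coord \<one>\<^bsub>Q\<^esub> h, \<one>\<^bsub>Q\<^esub>)"
  by (simp add: wreath_embed_def coord_def)

lemma wreath_embed_hom: "wreath_embed H Q \<in> hom H W"
proof (rule homI)
  fix h k assume "h \<in> carrier H" "k \<in> carrier H"
  then show "wreath_embed H Q (h \<otimes>\<^bsub>H\<^esub> k) = wreath_embed H Q h \<otimes>\<^bsub>W\<^esub> wreath_embed H Q k"
    by (auto simp: wreath_embed_eq W_mult act_one coord_closed, auto simp: N_mult coord_def)
qed (simp add: wreath_embed_eq W_iff coord_closed)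

definition section_map :: "'q \<Rightarrow> ('q \<Rightarrow> 'h) \<times> 'q"
  where "section_map q = (\<one>\<^bsub>N\<^esub>, q)"

lemma section_hom: "section_map \<in> hom Q W"
  by (rule homI) (auto simp: section_map_def W_iff W_mult act_N_one)

lemma wreath_proj_hom: "wreath_proj \<in> hom W Q"
  by (rule homI) (auto simp: wreath_proj_def W_iff W_mult)

text \<open>Conjugation by \<open>x\<close> carries the coordinate at the identity to the coordinate
  at \<open>x\<close>, so lifts at all coordinates can be obtained from lifts of one copy of
  \<open>H\<close>.\<close>

lemma conj_embed:
  assumes x: "x \<in> carrier Q" and h: "h \<in> carrier H"
  shows "section_map x \<otimes>\<^bsub>W\<^esub> wreath_embed H Q h \<otimes>\<^bsub>W\<^esub> inv\<^bsub>W\<^esub> section_map x = (coord x h, \<one>\<^bsub>Q\<^esub>)"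
proof -
  have "wreath_act Q x (coord \<one>\<^bsub>Q\<^esub> h) = coord x h"
  proof (rule N_ext)
    fix y assume y: "y \<in> carrier Q"
    have "inv\<^bsub>Q\<^esub> x \<otimes>\<^bsub>Q\<^esub> y = \<one>\<^bsub>Q\<^esub> \<longleftrightarrow> y = x"
      using x y by (metis Q.inv_closed Q.inv_equality Q.inv_inv Q.l_inv)
    then show "wreath_act Q x (coord \<one>\<^bsub>Q\<^esub> h) y = coord x h y"
      using x y by (simp add: act_app, simp add: coord_def)
  qed (simp_all add: x h act_closed coord_closed)
  then have "section_map x \<otimes>\<^bsub>W\<^esub> wreath_embed H Q h = (coord x h, \<one>\<^bsub>Q\<^esub>) \<otimes>\<^bsub>W\<^esub> section_map x"
    using x h by (simp add: section_map_def wreath_embed_eq W_mult act_closed coord_closed act_one)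
  moreover have "(coord x h, \<one>\<^bsub>Q\<^esub>) \<in> carrier W" "section_map x \<in> carrier W"
    using x h by (simp_all add: W_iff coord_closed section_map_def)
  ultimately show ?thesis by (simp add: W.m_assoc)
qed

text \<open>The supports are disjoint. Combined with \<open>lift_commute\<close>, this makes lifts
  at different coordinates commute in the extension.\<close>

lemma coord_commute:
  assumes "x \<noteq> y" "h \<in> carrier H" "k \<in> carrier H"
  shows "(coord x h, \<one>\<^bsub>Q\<^esub>) \<otimes>\<^bsub>W\<^esub> (coord y k, \<one>\<^bsub>Q\<^esub>) = (coord y k, \<one>\<^bsub>Q\<^esub>) \<otimes>\<^bsub>W\<^esub> (coord x h, \<one>\<^bsub>Q\<^esub>)"
  using assms by (simp add: W_mult act_one coord_closed) (auto simp: N_mult coord_def)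

end

section \<open>An explicit section of a central extension with commuting lifts\<close>

text \<open>
  The group \<open>E\<close> is an extension of the wreath product by the image of \<open>j\<close> in which commuting elements
  have commuting lifts; taking one of the elements trivial shows that the extension is central.
\<close>

locale wreath_lift = wreath_groups H Q + E: group E + X: comm_group X
  for H :: "('h, 'c) monoid_scheme" and Q :: "('q, 'd) monoid_scheme"
    and E :: "('e, 'f) monoid_scheme" and X :: "('x, 'y) monoid_scheme" +
  fixes p :: "'e \<Rightarrow> ('q \<Rightarrow> 'h) \<times> 'q" and j :: "'x \<Rightarrow> 'e"
    and a :: "'h \<Rightarrow> 'e" and b :: "'q \<Rightarrow> 'e"
    and \<zeta> :: "'h \<Rightarrow> 'h \<Rightarrow> 'x" and \<eta> :: "'q \<Rightarrow> 'q \<Rightarrow> 'x"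
  assumes p_hom: "p \<in> hom E (wreath_product H Q)" and j_hom: "j \<in> hom X E"
    and p_j: "z \<in> carrier X \<Longrightarrow> p (j z) = \<one>\<^bsub>wreath_product H Q\<^esub>"
    and lift_commute: "u \<in> carrier E \<Longrightarrow> v \<in> carrier E \<Longrightarrow>
      p u \<otimes>\<^bsub>wreath_product H Q\<^esub> p v = p v \<otimes>\<^bsub>wreath_product H Q\<^esub> p u \<Longrightarrow> u \<otimes>\<^bsub>E\<^esub> v = v \<otimes>\<^bsub>E\<^esub> u"
    and a_closed: "h \<in> carrier H \<Longrightarrow> a h \<in> carrier E"
    and p_a: "h \<in> carrier H \<Longrightarrow> p (a h) = wreath_embed H Q h"
    and a_one: "a \<one>\<^bsub>H\<^esub> = \<one>\<^bsub>E\<^esub>"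
    and b_closed: "q \<in> carrier Q \<Longrightarrow> b q \<in> carrier E"
    and p_b: "q \<in> carrier Q \<Longrightarrow> p (b q) = (\<one>\<^bsub>wreath_base H Q\<^esub>, q)"
    and \<zeta>_closed: "h \<in> carrier H \<Longrightarrow> k \<in> carrier H \<Longrightarrow> \<zeta> h k \<in> carrier X"
    and \<eta>_closed: "q \<in> carrier Q \<Longrightarrow> r \<in> carrier Q \<Longrightarrow> \<eta> q r \<in> carrier X"
    and \<zeta>_one: "k \<in> carrier H \<Longrightarrow> \<zeta> \<one>\<^bsub>H\<^esub> k = \<one>\<^bsub>X\<^esub>"
    and a_mult: "h \<in> carrier H \<Longrightarrow> k \<in> carrier H \<Longrightarrow> a h \<otimes>\<^bsub>E\<^esub> a k = a (h \<otimes>\<^bsub>H\<^esub> k) \<otimes>\<^bsub>E\<^esub> j (\<zeta> h k)"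
    and b_mult: "q \<in> carrier Q \<Longrightarrow> r \<in> carrier Q \<Longrightarrow> b q \<otimes>\<^bsub>E\<^esub> b r = b (q \<otimes>\<^bsub>Q\<^esub> r) \<otimes>\<^bsub>E\<^esub> j (\<eta> q r)"
begin

sublocale p: group_hom E W p
  by unfold_locales (rule p_hom)

sublocale j: group_hom X E j
  by unfold_locales (rule j_hom)

lemma j_central: "z \<in> carrier X \<Longrightarrow> u \<in> carrier E \<Longrightarrow> j z \<otimes>\<^bsub>E\<^esub> u = u \<otimes>\<^bsub>E\<^esub> j z"
  by (rule lift_commute) (simp_all add: p_j)

text \<open>Lifts at \<open>x\<close> are conjugates of the fixed lifts \<open>a h\<close> rather
  than independent choices. This gives every coordinate the same cocycle and lets \<open>b q\<close>
  permute the lifts without correction terms.\<close>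

definition t :: "'q \<Rightarrow> 'h \<Rightarrow> 'e"
  where "t x h = b x \<otimes>\<^bsub>E\<^esub> a h \<otimes>\<^bsub>E\<^esub> inv\<^bsub>E\<^esub> b x"

lemma t_closed [simp]: "x \<in> carrier Q \<Longrightarrow> h \<in> carrier H \<Longrightarrow> t x h \<in> carrier E"
  by (simp add: t_def a_closed b_closed)

lemma p_t: "x \<in> carrier Q \<Longrightarrow> h \<in> carrier H \<Longrightarrow> p (t x h) = (coord x h, \<one>\<^bsub>Q\<^esub>)"
  using conj_embed[of x h] by (simp add: t_def a_closed b_closed p_a p_b section_map_def)

lemma t_one: "x \<in> carrier Q \<Longrightarrow> t x \<one>\<^bsub>H\<^esub> = \<one>\<^bsub>E\<^esub>"
  by (simp add: t_def a_one b_closed)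

lemma t_commute:
  "x \<noteq> y \<Longrightarrow> x \<in> carrier Q \<Longrightarrow> y \<in> carrier Q \<Longrightarrow> h \<in> carrier H \<Longrightarrow> k \<in> carrier H \<Longrightarrow>
    t x h \<otimes>\<^bsub>E\<^esub> t y k = t y k \<otimes>\<^bsub>E\<^esub> t x h"
  by (rule lift_commute) (simp_all add: p_t coord_commute)

text \<open>Conjugation by \<open>b x\<close> is an automorphism that fixes the central element
  \<open>j (\<zeta> h k)\<close>, so the relation \<open>a_mult\<close> is transported unchanged to
  the coordinate \<open>x\<close>.\<close>

lemma t_mult:
  assumes "x \<in> carrier Q" "h \<in> carrier H" "k \<in> carrier H"
  shows "t x h \<otimes>\<^bsub>E\<^esub> t x k = t x (h \<otimes>\<^bsub>H\<^esub> k) \<otimes>\<^bsub>E\<^esub> j (\<zeta> h k)"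
proof -
  note [simp] = a_closed b_closed \<zeta>_closed assms
  have "t x h \<otimes>\<^bsub>E\<^esub> t x k = b x \<otimes>\<^bsub>E\<^esub> (a h \<otimes>\<^bsub>E\<^esub> (inv\<^bsub>E\<^esub> b x \<otimes>\<^bsub>E\<^esub> b x) \<otimes>\<^bsub>E\<^esub> a k) \<otimes>\<^bsub>E\<^esub> inv\<^bsub>E\<^esub> b x"
    unfolding t_def by (simp add: E.m_assoc E.inv_mult_cancel)
  also have "\<dots> = b x \<otimes>\<^bsub>E\<^esub> a (h \<otimes>\<^bsub>H\<^esub> k) \<otimes>\<^bsub>E\<^esub> (j (\<zeta> h k) \<otimes>\<^bsub>E\<^esub> inv\<^bsub>E\<^esub> b x)"
    by (simp add: a_mult E.m_assoc)
  also have "\<dots> = t x (h \<otimes>\<^bsub>H\<^esub> k) \<otimes>\<^bsub>E\<^esub> j (\<zeta> h k)"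
    by (simp add: j_central t_def E.m_assoc)
  finally show ?thesis .
qed

text \<open>The elements \<open>b q b x\<close> and \<open>b (q x)\<close> differ by a central
  factor, so both conjugate \<open>a h\<close> to the same element and no correction
  appears.\<close>

lemma b_t:
  assumes "q \<in> carrier Q" "x \<in> carrier Q" "h \<in> carrier H"
  shows "b q \<otimes>\<^bsub>E\<^esub> t x h = t (q \<otimes>\<^bsub>Q\<^esub> x) h \<otimes>\<^bsub>E\<^esub> b q"
proof -
  note [simp] = a_closed b_closed \<eta>_closed assms
  let ?z = "j (\<eta> q x)" and ?c = "b (q \<otimes>\<^bsub>Q\<^esub> x)"
  have bb: "b q \<otimes>\<^bsub>E\<^esub> b x = ?c \<otimes>\<^bsub>E\<^esub> ?z" by (simp add: b_mult)
  then have c: "b q = ?c \<otimes>\<^bsub>E\<^esub> ?z \<otimes>\<^bsub>E\<^esub> inv\<^bsub>E\<^esub> b x"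
    by (simp add: E.inv_solve_right)
  have "t (q \<otimes>\<^bsub>Q\<^esub> x) h \<otimes>\<^bsub>E\<^esub> b q = ?c \<otimes>\<^bsub>E\<^esub> a h \<otimes>\<^bsub>E\<^esub> ((inv\<^bsub>E\<^esub> ?c \<otimes>\<^bsub>E\<^esub> ?c) \<otimes>\<^bsub>E\<^esub> ?z \<otimes>\<^bsub>E\<^esub> inv\<^bsub>E\<^esub> b x)"
    unfolding t_def by (subst c) (simp add: E.m_assoc E.inv_mult_cancel)
  also have "\<dots> = ?c \<otimes>\<^bsub>E\<^esub> (a h \<otimes>\<^bsub>E\<^esub> ?z) \<otimes>\<^bsub>E\<^esub> inv\<^bsub>E\<^esub> b x"
    by (simp add: E.m_assoc)
  also have "a h \<otimes>\<^bsub>E\<^esub> ?z = ?z \<otimes>\<^bsub>E\<^esub> a h"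
    by (simp add: j_central)
  also have "?c \<otimes>\<^bsub>E\<^esub> (?z \<otimes>\<^bsub>E\<^esub> a h) \<otimes>\<^bsub>E\<^esub> inv\<^bsub>E\<^esub> b x = (b q \<otimes>\<^bsub>E\<^esub> b x) \<otimes>\<^bsub>E\<^esub> a h \<otimes>\<^bsub>E\<^esub> inv\<^bsub>E\<^esub> b x"
    by (simp add: bb E.m_assoc)
  also have "\<dots> = b q \<otimes>\<^bsub>E\<^esub> t x h"
    by (simp add: t_def E.m_assoc)
  finally show ?thesis by simp
qed

text \<open>
  A product of lifts, one for each coordinate. The factors commute pairwise but \<open>E\<close> is not abelian,
  so \<open>finprod\<close> is not available.
\<close>

definition base_lift :: "'q set \<Rightarrow> ('q \<Rightarrow> 'h) \<Rightarrow> 'e"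
  where "base_lift S n = foldD (carrier E) (\<lambda>x e. t x (n x) \<otimes>\<^bsub>E\<^esub> e) \<one>\<^bsub>E\<^esub> S"

text \<open>Left commutativity makes the fold independent of the order of the coordinates. For
  distinct coordinates it comes from \<open>t_commute\<close>.\<close>

lemma LCD_t:
  assumes "n \<in> carrier N"
  shows "LCD (carrier Q) (carrier E) (\<lambda>x e. t x (n x) \<otimes>\<^bsub>E\<^esub> e)"
proof
  fix x y e assume "x \<in> carrier Q" "y \<in> carrier Q" "e \<in> carrier E"
  then show "t x (n x) \<otimes>\<^bsub>E\<^esub> (t y (n y) \<otimes>\<^bsub>E\<^esub> e) = t y (n y) \<otimes>\<^bsub>E\<^esub> (t x (n x) \<otimes>\<^bsub>E\<^esub> e)"
    using t_commute[of x y "n x" "n y"] assms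
    by (cases "x = y") (simp_all add: N_app E.m_assoc[symmetric])
qed (simp add: assms N_app)

lemma base_lift_empty [simp]: "base_lift {} n = \<one>\<^bsub>E\<^esub>"
  by (simp add: base_lift_def)

lemma base_lift_insert:
  "n \<in> carrier N \<Longrightarrow> finite S \<Longrightarrow> x \<notin> S \<Longrightarrow> insert x S \<subseteq> carrier Q \<Longrightarrow>
    base_lift (insert x S) n = t x (n x) \<otimes>\<^bsub>E\<^esub> base_lift S n"
  unfolding base_lift_def by (rule LCD.foldD_insert[OF LCD_t]) auto

lemma base_lift_closed:
  "n \<in> carrier N \<Longrightarrow> finite S \<Longrightarrow> S \<subseteq> carrier Q \<Longrightarrow> base_lift S n \<in> carrier E"
  unfolding base_lift_def by (rule LCD.foldD_closed[OF LCD_t]) auto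

lemma t_base_lift:
  assumes "n \<in> carrier N" "finite S" "S \<subseteq> carrier Q" "x \<in> carrier Q" "x \<notin> S" "h \<in> carrier H"
  shows "t x h \<otimes>\<^bsub>E\<^esub> base_lift S n = base_lift S n \<otimes>\<^bsub>E\<^esub> t x h"
  using assms(2,3,5)
proof (induction S rule: finite_induct)
  case (insert y S)
  have "t x h \<otimes>\<^bsub>E\<^esub> (t y (n y) \<otimes>\<^bsub>E\<^esub> base_lift S n) = t x h \<otimes>\<^bsub>E\<^esub> t y (n y) \<otimes>\<^bsub>E\<^esub> base_lift S n"
    using insert assms by (simp add: E.m_assoc base_lift_closed N_app)
  also have "\<dots> = t y (n y) \<otimes>\<^bsub>E\<^esub> t x h \<otimes>\<^bsub>E\<^esub> base_lift S n"
    using insert assms by (subst t_commute) (auto simp: N_app)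
  also have "\<dots> = t y (n y) \<otimes>\<^bsub>E\<^esub> base_lift S n \<otimes>\<^bsub>E\<^esub> t x h"
    using insert assms by (simp add: E.m_assoc base_lift_closed N_app)
  finally show ?case using insert assms by (simp add: base_lift_insert)
qed (use assms in simp)

lemma p_base_lift:
  assumes "n \<in> carrier N" "finite S" "S \<subseteq> carrier Q"
  shows "p (base_lift S n) = ((\<lambda>x\<in>carrier Q. if x \<in> S then n x else \<one>\<^bsub>H\<^esub>), \<one>\<^bsub>Q\<^esub>)"
  using assms(2,3)
proof (induction S rule: finite_induct)
  case empty
  then show ?case by (simp add: W_one N_one restrict_def)
next
  case (insert y S)
  define k where "k = (\<lambda>x\<in>carrier Q. if x \<in> S then n x else \<one>\<^bsub>H\<^esub>)"
  have IH: "p (base_lift S n) = (k, \<one>\<^bsub>Q\<^esub>)"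
    unfolding k_def using insert by blast
  have "supp k \<subseteq> S" by (auto simp: supp_def k_def)
  then have k: "k \<in> carrier N"
    using insert(1) assms(1) finite_subset[of "supp k" S] by (auto simp: N_iff k_def)
  then have "p (base_lift (insert y S) n) = (coord y (n y) \<otimes>\<^bsub>N\<^esub> k, \<one>\<^bsub>Q\<^esub>)"
    using insert(1,2,4) assms IH by (simp add: base_lift_insert base_lift_closed p_t N_app W_mult act_one)
  moreover have "coord y (n y) \<otimes>\<^bsub>N\<^esub> k = (\<lambda>x\<in>carrier Q. if x \<in> insert y S then n x else \<one>\<^bsub>H\<^esub>)"
    using insert(2,4) assms(1) by (auto simp: N_mult coord_def k_def N_app)
  ultimately show ?case by (simp only:)
qed

text \<open>Factors outside the support are \<open>t x \<one> = \<one>\<close>, since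
  \<open>a\<close> is normalized. Lifts of several base elements can therefore be compared over one
  common finite set.\<close>

lemma base_lift_supp:
  assumes "n \<in> carrier N" "finite T" "supp n \<subseteq> T" "T \<subseteq> carrier Q"
  shows "base_lift T n = base_lift (supp n) n"
proof -
  have "base_lift T n = base_lift {x \<in> T. n x \<noteq> \<one>\<^bsub>H\<^esub>} n"
    using assms(2,4)
  proof (induction T rule: finite_induct)
    case (insert x T)
    have "{y \<in> insert x T. n y \<noteq> \<one>\<^bsub>H\<^esub>} =
        (if n x = \<one>\<^bsub>H\<^esub> then {y \<in> T. n y \<noteq> \<one>\<^bsub>H\<^esub>} else insert x {y \<in> T. n y \<noteq> \<one>\<^bsub>H\<^esub>})" by auto
    then show ?case
      using insert assms(1)
      by (auto simp: base_lift_insert t_one base_lift_closed subset_iff)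
  qed simp
  also have "{x \<in> T. n x \<noteq> \<one>\<^bsub>H\<^esub>} = supp n" using assms by (auto simp: supp_def)
  finally show ?thesis .
qed

text \<open>Each \<open>t x (m x)\<close> passes the factors of \<open>n\<close> at the other
  coordinates, so only factors at equal coordinates are merged. Each merger leaves one central value
  of \<open>\<zeta>\<close>.\<close>

lemma base_lift_mult:
  assumes nm: "n \<in> carrier N" "m \<in> carrier N" and S: "finite S" "S \<subseteq> carrier Q"
  shows "base_lift S n \<otimes>\<^bsub>E\<^esub> base_lift S m
    = base_lift S (n \<otimes>\<^bsub>N\<^esub> m) \<otimes>\<^bsub>E\<^esub> j (finprod X (\<lambda>x. \<zeta> (n x) (m x)) S)"
  using S
proof (induction S rule: finite_induct)
  case (insert x S)
  let ?n = "base_lift S n" and ?m = "base_lift S m" and ?nm = "base_lift S (n \<otimes>\<^bsub>N\<^esub> m)"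
  let ?z = "\<zeta> (n x) (m x)" and ?f = "finprod X (\<lambda>x. \<zeta> (n x) (m x)) S"
  have x: "x \<in> carrier Q" and S: "S \<subseteq> carrier Q" using insert by auto
  have f: "(\<lambda>x. \<zeta> (n x) (m x)) \<in> S \<rightarrow> carrier X" using S nm by (auto intro!: \<zeta>_closed N_app)
  have z: "?z \<in> carrier X" using x nm by (simp add: \<zeta>_closed N_app)
  have nmx: "(n \<otimes>\<^bsub>N\<^esub> m) x = n x \<otimes>\<^bsub>H\<^esub> m x" using x by (simp add: N_mult)
  note [simp] = base_lift_closed[OF nm(1) insert(1) S] base_lift_closed[OF nm(2) insert(1) S]
    base_lift_closed[OF N.m_closed[OF nm] insert(1) S] N_app[OF nm(1) x] N_app[OF nm(2) x] x z
    X.finprod_closed[OF f]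
  have "base_lift (insert x S) n \<otimes>\<^bsub>E\<^esub> base_lift (insert x S) m
      = t x (n x) \<otimes>\<^bsub>E\<^esub> (?n \<otimes>\<^bsub>E\<^esub> t x (m x)) \<otimes>\<^bsub>E\<^esub> ?m"
    using insert nm by (simp add: base_lift_insert E.m_assoc)
  also have "\<dots> = (t x (n x) \<otimes>\<^bsub>E\<^esub> t x (m x)) \<otimes>\<^bsub>E\<^esub> (?n \<otimes>\<^bsub>E\<^esub> ?m)"
    using insert nm S by (simp add: t_base_lift[symmetric] E.m_assoc)
  also have "\<dots> = t x (n x \<otimes>\<^bsub>H\<^esub> m x) \<otimes>\<^bsub>E\<^esub> (j ?z \<otimes>\<^bsub>E\<^esub> ?nm) \<otimes>\<^bsub>E\<^esub> j ?f"
    using insert.IH S by (simp add: t_mult E.m_assoc)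
  also have "\<dots> = t x (n x \<otimes>\<^bsub>H\<^esub> m x) \<otimes>\<^bsub>E\<^esub> ?nm \<otimes>\<^bsub>E\<^esub> (j ?z \<otimes>\<^bsub>E\<^esub> j ?f)"
    by (subst j_central[of ?z ?nm]) (simp_all add: E.m_assoc)
  also have "\<dots> = base_lift (insert x S) (n \<otimes>\<^bsub>N\<^esub> m) \<otimes>\<^bsub>E\<^esub> j (?z \<otimes>\<^bsub>X\<^esub> ?f)"
    using insert nm S by (simp add: base_lift_insert nmx)
  also have "?z \<otimes>\<^bsub>X\<^esub> ?f = finprod X (\<lambda>x. \<zeta> (n x) (m x)) (insert x S)"
    using insert f by (simp add: X.finprod_insert)
  finally show ?case .
qed simp

text \<open>Apply \<open>b_t\<close> factor by factor: the factor at \<open>x\<close> becomes one at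
  \<open>q x\<close>, where the translated function has the entry \<open>n x\<close>.\<close>

lemma b_base_lift:
  assumes q: "q \<in> carrier Q" and n: "n \<in> carrier N" and S: "finite S" "S \<subseteq> carrier Q"
  shows "b q \<otimes>\<^bsub>E\<^esub> base_lift S n
    = base_lift ((\<lambda>x. q \<otimes>\<^bsub>Q\<^esub> x) ` S) (wreath_act Q q n) \<otimes>\<^bsub>E\<^esub> b q"
  using S
proof (induction S rule: finite_induct)
  case (insert x S)
  let ?S = "(\<lambda>x. q \<otimes>\<^bsub>Q\<^esub> x) ` S" and ?n = "wreath_act Q q n"
  have x: "x \<in> carrier Q" and S: "S \<subseteq> carrier Q" using insert by auto
  have notin: "q \<otimes>\<^bsub>Q\<^esub> x \<notin> ?S" using insert q by auto
  have Sq: "?S \<subseteq> carrier Q" using q S by auto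
  have nx: "?n (q \<otimes>\<^bsub>Q\<^esub> x) = n x" using q x by (simp add: act_app Q.m_assoc[symmetric])
  note [simp] = base_lift_closed[OF n insert(1) S] base_lift_closed[OF act_closed[OF q n] finite_imageI[OF insert(1)] Sq]
    N_app[OF n x] b_closed[OF q] q x
  have "b q \<otimes>\<^bsub>E\<^esub> base_lift (insert x S) n = (b q \<otimes>\<^bsub>E\<^esub> t x (n x)) \<otimes>\<^bsub>E\<^esub> base_lift S n"
    using insert n by (simp add: base_lift_insert E.m_assoc)
  also have "\<dots> = t (q \<otimes>\<^bsub>Q\<^esub> x) (n x) \<otimes>\<^bsub>E\<^esub> (base_lift ?S ?n \<otimes>\<^bsub>E\<^esub> b q)"
    using insert.IH S by (simp add: b_t E.m_assoc)
  also have "\<dots> = base_lift (insert (q \<otimes>\<^bsub>Q\<^esub> x) ?S) ?n \<otimes>\<^bsub>E\<^esub> b q"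
    using insert(1) notin n Sq by (simp add: base_lift_insert act_closed nx E.m_assoc)
  finally show ?case by simp
qed (simp add: q b_closed)

definition wlift :: "('q \<Rightarrow> 'h) \<times> 'q \<Rightarrow> 'e"
  where "wlift = (\<lambda>(n, q). base_lift (supp n) n \<otimes>\<^bsub>E\<^esub> b q)"

lemma wlift_closed:
  assumes "n \<in> carrier N" "q \<in> carrier Q"
  shows "wlift (n, q) \<in> carrier E"
  using assms by (simp add: wlift_def base_lift_closed finite_supp supp_subset b_closed)

lemma p_wlift:
  assumes "n \<in> carrier N" "q \<in> carrier Q"
  shows "p (wlift (n, q)) = (n, q)"
proof -
  have "(\<lambda>x\<in>carrier Q. if x \<in> supp n then n x else \<one>\<^bsub>H\<^esub>) = n"
    using assms by (auto simp: N_iff supp_def fun_eq_iff PiE_def extensional_def)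
  then show ?thesis
    using assms by (simp add: wlift_def base_lift_closed finite_supp supp_subset b_closed p_base_lift
        p_b W_mult act_N_one)
qed

text \<open>Move \<open>b q\<close> past the lift of \<open>m\<close>, which translates
  \<open>m\<close> by \<open>q\<close>; then merge the two base lifts and the two lifts from
  \<open>Q\<close>, and collect the central factors on the right.\<close>

lemma wlift_mult:
  assumes n: "n \<in> carrier N" and q: "q \<in> carrier Q" and m: "m \<in> carrier N" and r: "r \<in> carrier Q"
  shows "wlift (n, q) \<otimes>\<^bsub>E\<^esub> wlift (m, r) = wlift ((n, q) \<otimes>\<^bsub>W\<^esub> (m, r)) \<otimes>\<^bsub>E\<^esub>
    j (finprod X (\<lambda>x. \<zeta> (n x) (m (inv\<^bsub>Q\<^esub> q \<otimes>\<^bsub>Q\<^esub> x))) (supp n) \<otimes>\<^bsub>X\<^esub> \<eta> q r)"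
proof -
  let ?m = "wreath_act Q q m"
  let ?z = "finprod X (\<lambda>x. \<zeta> (n x) (m (inv\<^bsub>Q\<^esub> q \<otimes>\<^bsub>Q\<^esub> x))) (supp n)"
  \<comment> \<open>A common index set for \<open>n\<close> and the translate of \<open>m\<close>;
    it also contains the support of their product.\<close>
  define S where "S = supp n \<union> supp ?m"
  have m': "?m \<in> carrier N" using q m by (rule act_closed)
  have S: "finite S" "S \<subseteq> carrier Q"
    using n m' by (auto simp: S_def finite_supp dest: subsetD[OF supp_subset])
  have nm: "n \<otimes>\<^bsub>N\<^esub> ?m \<in> carrier N" using n m' by simp
  have supp_nm: "supp (n \<otimes>\<^bsub>N\<^esub> ?m) \<subseteq> S"
    by (auto simp: S_def supp_def N_mult)
  have f: "(\<lambda>x. \<zeta> (n x) (?m x)) \<in> S \<rightarrow> carrier X"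
    using S n m' by (auto intro!: \<zeta>_closed N_app)
  \<comment> \<open>Outside the support of \<open>n\<close> the first argument of
    \<open>\<zeta>\<close> is the identity, so by \<open>\<zeta>_one\<close> the product shrinks
    from \<open>S\<close> to a set that depends on \<open>n\<close> alone.\<close>
  have "finprod X (\<lambda>x. \<zeta> (n x) (?m x)) S = finprod X (\<lambda>x. \<zeta> (n x) (m (inv\<^bsub>Q\<^esub> q \<otimes>\<^bsub>Q\<^esub> x))) (supp n)"
  proof (rule X.finprod_mono_neutral_cong_right)
    fix x assume "x \<in> S - supp n"
    then show "\<zeta> (n x) (?m x) = \<one>\<^bsub>X\<^esub>"
      using S m' \<zeta>_one by (auto simp: supp_def N_app)
  next
    fix x assume "x \<in> supp n"
    then show "\<zeta> (n x) (?m x) = \<zeta> (n x) (m (inv\<^bsub>Q\<^esub> q \<otimes>\<^bsub>Q\<^esub> x))"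
      by (simp add: act_app supp_def)
  qed (use S f in \<open>auto simp: S_def\<close>)
  then have prod: "base_lift S n \<otimes>\<^bsub>E\<^esub> base_lift S ?m = base_lift S (n \<otimes>\<^bsub>N\<^esub> ?m) \<otimes>\<^bsub>E\<^esub> j ?z"
    and z: "?z \<in> carrier X"
    using base_lift_mult[OF n m' S] X.finprod_closed[OF f] by simp_all
  have eqs: "base_lift (supp n) n = base_lift S n" "base_lift (supp ?m) ?m = base_lift S ?m"
    "base_lift (supp (n \<otimes>\<^bsub>N\<^esub> ?m)) (n \<otimes>\<^bsub>N\<^esub> ?m) = base_lift S (n \<otimes>\<^bsub>N\<^esub> ?m)"
    using base_lift_supp[OF n S(1) _ S(2)] base_lift_supp[OF m' S(1) _ S(2)]
      base_lift_supp[OF nm S(1) supp_nm S(2)] by (auto simp: S_def)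
  note [simp] = base_lift_closed[OF n S] base_lift_closed[OF m' S] base_lift_closed[OF nm S]
    base_lift_closed[OF m finite_supp[OF m] supp_subset] b_closed[OF q] b_closed[OF r] z
    \<eta>_closed[OF q r] b_closed[OF Q.m_closed[OF q r]]
  have "wlift (n, q) \<otimes>\<^bsub>E\<^esub> wlift (m, r)
      = base_lift S n \<otimes>\<^bsub>E\<^esub> (b q \<otimes>\<^bsub>E\<^esub> base_lift (supp m) m) \<otimes>\<^bsub>E\<^esub> b r"
    by (simp add: wlift_def eqs E.m_assoc)
  also have "b q \<otimes>\<^bsub>E\<^esub> base_lift (supp m) m = base_lift S ?m \<otimes>\<^bsub>E\<^esub> b q"
    using b_base_lift[OF q m finite_supp[OF m] supp_subset] by (simp add: supp_act[OF q, symmetric] eqs)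
  also have "base_lift S n \<otimes>\<^bsub>E\<^esub> (base_lift S ?m \<otimes>\<^bsub>E\<^esub> b q) \<otimes>\<^bsub>E\<^esub> b r
      = (base_lift S n \<otimes>\<^bsub>E\<^esub> base_lift S ?m) \<otimes>\<^bsub>E\<^esub> (b q \<otimes>\<^bsub>E\<^esub> b r)"
    by (simp add: E.m_assoc)
  also have "\<dots> = base_lift S (n \<otimes>\<^bsub>N\<^esub> ?m) \<otimes>\<^bsub>E\<^esub> (j ?z \<otimes>\<^bsub>E\<^esub> b (q \<otimes>\<^bsub>Q\<^esub> r)) \<otimes>\<^bsub>E\<^esub> j (\<eta> q r)"
    using q r by (simp add: prod b_mult E.m_assoc)
  also have "\<dots> = base_lift S (n \<otimes>\<^bsub>N\<^esub> ?m) \<otimes>\<^bsub>E\<^esub> b (q \<otimes>\<^bsub>Q\<^esub> r) \<otimes>\<^bsub>E\<^esub> j (?z \<otimes>\<^bsub>X\<^esub> \<eta> q r)"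
    by (subst j_central[of ?z "b (q \<otimes>\<^bsub>Q\<^esub> r)"]) (simp_all add: E.m_assoc)
  finally show ?thesis by (simp add: wlift_def W_mult eqs)
qed

end

section \<open>Central extensions attached to normalized 2-cocycles\<close>

definition twisted_product ::
  "('x, 'y) monoid_scheme \<Rightarrow> ('g, 'z) monoid_scheme \<Rightarrow> ('g \<Rightarrow> 'g \<Rightarrow> 'x) \<Rightarrow> ('x \<times> 'g) monoid"
  where "twisted_product X G c =
    \<lparr>carrier = carrier X \<times> carrier G,
     monoid.mult = (\<lambda>(u, x) (v, y). (u \<otimes>\<^bsub>X\<^esub> v \<otimes>\<^bsub>X\<^esub> c x y, x \<otimes>\<^bsub>G\<^esub> y)),
     one = (\<one>\<^bsub>X\<^esub>, \<one>\<^bsub>G\<^esub>)\<rparr>"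

lemma twisted_product_simps [simp]:
  "carrier (twisted_product X G c) = carrier X \<times> carrier G"
  "(u, x) \<otimes>\<^bsub>twisted_product X G c\<^esub> (v, y) = (u \<otimes>\<^bsub>X\<^esub> v \<otimes>\<^bsub>X\<^esub> c x y, x \<otimes>\<^bsub>G\<^esub> y)"
  "\<one>\<^bsub>twisted_product X G c\<^esub> = (\<one>\<^bsub>X\<^esub>, \<one>\<^bsub>G\<^esub>)"
  by (simp_all add: twisted_product_def)

locale normalized_cocycle = X: comm_group X + G: group G
  for X :: "('x, 'y) monoid_scheme" and G :: "('g, 'z) monoid_scheme" +
  fixes c :: "'g \<Rightarrow> 'g \<Rightarrow> 'x"
  assumes c_closed [simp]: "x \<in> carrier G \<Longrightarrow> y \<in> carrier G \<Longrightarrow> c x y \<in> carrier X"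
    and c_one [simp]: "x \<in> carrier G \<Longrightarrow> c \<one>\<^bsub>G\<^esub> x = \<one>\<^bsub>X\<^esub>" "x \<in> carrier G \<Longrightarrow> c x \<one>\<^bsub>G\<^esub> = \<one>\<^bsub>X\<^esub>"
    and cocycle: "x \<in> carrier G \<Longrightarrow> y \<in> carrier G \<Longrightarrow> z \<in> carrier G \<Longrightarrow>
      c x y \<otimes>\<^bsub>X\<^esub> c (x \<otimes>\<^bsub>G\<^esub> y) z = c y z \<otimes>\<^bsub>X\<^esub> c x (y \<otimes>\<^bsub>G\<^esub> z)"
begin

text \<open>Associativity in the first component is exactly the cocycle identity, and normalization
  makes the pair of identities neutral.\<close>

lemma group_twisted_product: "group (twisted_product X G c)"
proof (rule groupI)
  fix e f g assume "e \<in> carrier (twisted_product X G c)" "f \<in> carrier (twisted_product X G c)"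
    "g \<in> carrier (twisted_product X G c)"
  then obtain u x v y w z where e: "e = (u, x)" "f = (v, y)" "g = (w, z)"
    and [simp]: "u \<in> carrier X" "v \<in> carrier X" "w \<in> carrier X"
      "x \<in> carrier G" "y \<in> carrier G" "z \<in> carrier G" by auto
  have "(u \<otimes>\<^bsub>X\<^esub> v \<otimes>\<^bsub>X\<^esub> c x y) \<otimes>\<^bsub>X\<^esub> w \<otimes>\<^bsub>X\<^esub> c (x \<otimes>\<^bsub>G\<^esub> y) z
      = u \<otimes>\<^bsub>X\<^esub> v \<otimes>\<^bsub>X\<^esub> w \<otimes>\<^bsub>X\<^esub> (c x y \<otimes>\<^bsub>X\<^esub> c (x \<otimes>\<^bsub>G\<^esub> y) z)"
    by (simp add: X.m_ac)
  also have "\<dots> = u \<otimes>\<^bsub>X\<^esub> (v \<otimes>\<^bsub>X\<^esub> w \<otimes>\<^bsub>X\<^esub> c y z) \<otimes>\<^bsub>X\<^esub> c x (y \<otimes>\<^bsub>G\<^esub> z)"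
    by (simp add: cocycle X.m_ac)
  finally show "e \<otimes>\<^bsub>twisted_product X G c\<^esub> f \<otimes>\<^bsub>twisted_product X G c\<^esub> g
      = e \<otimes>\<^bsub>twisted_product X G c\<^esub> (f \<otimes>\<^bsub>twisted_product X G c\<^esub> g)"
    by (simp add: e G.m_assoc)
next
  fix e assume "e \<in> carrier (twisted_product X G c)"
  then obtain u x where e: "e = (u, x)" "u \<in> carrier X" "x \<in> carrier G" by auto
  then show "\<exists>f\<in>carrier (twisted_product X G c). f \<otimes>\<^bsub>twisted_product X G c\<^esub> e = \<one>\<^bsub>twisted_product X G c\<^esub>"
    \<comment> \<open>The first component of the left inverse must cancel both \<open>u\<close> and
      the cocycle value at \<open>inv x\<close> and \<open>x\<close>.\<close>
    by (intro bexI[where x = "(inv\<^bsub>X\<^esub> (u \<otimes>\<^bsub>X\<^esub> c (inv\<^bsub>G\<^esub> x) x), inv\<^bsub>G\<^esub> x)"])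
      (auto simp: X.m_assoc)
qed auto

end

text \<open>In the extension defined by \<open>c\<close>, the section sending \<open>w\<close> to
  \<open>(\<one>, w)\<close> has cocycle \<open>c\<close>, while \<open>wlift\<close> has the
  explicit cocycle of \<open>wlift_mult\<close>. The two sections differ by \<open>\<beta>\<close>,
  so the two cocycles differ by the coboundary of \<open>\<beta>\<close>.\<close>

lemma (in wreath_groups) cocycle_decomposition:
  fixes X :: "('x, 'y) monoid_scheme"
  assumes "normalized_cocycle X W c"
    and comm: "\<And>w v. w \<in> carrier W \<Longrightarrow> v \<in> carrier W \<Longrightarrow> w \<otimes>\<^bsub>W\<^esub> v = v \<otimes>\<^bsub>W\<^esub> w \<Longrightarrow> c w v = c v w"
  obtains \<beta> where "\<And>w. w \<in> carrier W \<Longrightarrow> \<beta> w \<in> carrier X"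
    and "\<And>n q m r. n \<in> carrier N \<Longrightarrow> q \<in> carrier Q \<Longrightarrow> m \<in> carrier N \<Longrightarrow> r \<in> carrier Q \<Longrightarrow>
      \<beta> (n, q) \<otimes>\<^bsub>X\<^esub> \<beta> (m, r) \<otimes>\<^bsub>X\<^esub> c (n, q) (m, r) = \<beta> ((n, q) \<otimes>\<^bsub>W\<^esub> (m, r)) \<otimes>\<^bsub>X\<^esub>
        (finprod X (\<lambda>x. c (wreath_embed H Q (n x)) (wreath_embed H Q (m (inv\<^bsub>Q\<^esub> q \<otimes>\<^bsub>Q\<^esub> x)))) (supp n)
          \<otimes>\<^bsub>X\<^esub> c (section_map q) (section_map r))"
proof -
  interpret c: normalized_cocycle X W c by fact
  let ?E = "twisted_product X W c"
  interpret \<iota>: group_hom H W "wreath_embed H Q" by unfold_locales (rule wreath_embed_hom)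
  interpret \<sigma>: group_hom Q W section_map by unfold_locales (rule section_hom)
  interpret L: wreath_lift H Q ?E X snd "\<lambda>z. (z, \<one>\<^bsub>W\<^esub>)" "\<lambda>h. (\<one>\<^bsub>X\<^esub>, wreath_embed H Q h)"
    "\<lambda>q. (\<one>\<^bsub>X\<^esub>, section_map q)" "\<lambda>h k. c (wreath_embed H Q h) (wreath_embed H Q k)"
    "\<lambda>q r. c (section_map q) (section_map r)"
  proof (intro wreath_lift.intro wreath_lift_axioms.intro)
    show "group ?E" by (rule c.group_twisted_product)
    \<comment> \<open>The two products have first components that differ only in the order of the
      arguments of \<open>c\<close>, and \<open>c\<close> is symmetric on commuting pairs.\<close>
    show "u \<otimes>\<^bsub>?E\<^esub> v = v \<otimes>\<^bsub>?E\<^esub> u"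
      if "u \<in> carrier ?E" "v \<in> carrier ?E" "snd u \<otimes>\<^bsub>W\<^esub> snd v = snd v \<otimes>\<^bsub>W\<^esub> snd u" for u v
      using that comm[of "snd u" "snd v"] by (cases u; cases v) (simp add: c.X.m_comm)
  qed (auto simp: wreath_groups_axioms c.X.comm_group_axioms hom_def section_map_def[symmetric])
  \<comment> \<open>Since \<open>wlift\<close> is a section of \<open>snd\<close>, its first
    component carries all of its information.\<close>
  define \<beta> where "\<beta> = (\<lambda>w. fst (L.wlift w))"
  have wl: "L.wlift (n, q) = (\<beta> (n, q), (n, q))" "\<beta> (n, q) \<in> carrier X"
    if "n \<in> carrier N" "q \<in> carrier Q" for n q
    using L.p_wlift[OF that] L.wlift_closed[OF that] by (auto simp: \<beta>_def prod_eq_iff mem_Times_iff)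
  show thesis
  proof (rule that)
    show "\<beta> w \<in> carrier X" if "w \<in> carrier W" for w
      using that wl by (cases w) (auto simp: W_iff)
    fix n q m r
    assume nq: "n \<in> carrier N" "q \<in> carrier Q" and mr: "m \<in> carrier N" "r \<in> carrier Q"
    let ?z = "finprod X (\<lambda>x. c (wreath_embed H Q (n x)) (wreath_embed H Q (m (inv\<^bsub>Q\<^esub> q \<otimes>\<^bsub>Q\<^esub> x)))) (supp n)
          \<otimes>\<^bsub>X\<^esub> c (section_map q) (section_map r)"
    have z: "?z \<in> carrier X"
      using nq mr by (auto intro!: c.X.m_closed c.X.finprod_closed c.c_closed \<iota>.hom_closed N_app simp: supp_def)
    have nm: "n \<otimes>\<^bsub>N\<^esub> wreath_act Q q m \<in> carrier N" "q \<otimes>\<^bsub>Q\<^esub> r \<in> carrier Q"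
      using nq mr by (simp_all add: act_closed)
    then have w: "(n \<otimes>\<^bsub>N\<^esub> wreath_act Q q m, q \<otimes>\<^bsub>Q\<^esub> r) \<in> carrier W" by (simp add: W_iff)
    from L.wlift_mult[OF nq mr]
    show "\<beta> (n, q) \<otimes>\<^bsub>X\<^esub> \<beta> (m, r) \<otimes>\<^bsub>X\<^esub> c (n, q) (m, r) = \<beta> ((n, q) \<otimes>\<^bsub>W\<^esub> (m, r)) \<otimes>\<^bsub>X\<^esub> ?z"
      using z wl(1)[OF nq] wl(1)[OF mr] wl[OF nm] w by (simp add: W_mult[of n q m r])
  qed
qed

section \<open>The exact sequence\<close>

context wreath_groups
begin

text \<open>
  The coordinatewise chain map from \<open>H wr Q\<close> to \<open>H\<close>: the coordinate at \<open>x\<close> of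
  \<open>(n, q) (m, r)\<close> is \<open>n\<^sub>x\<close> times the coordinate of \<open>m\<close> at \<open>q\<^sup>-\<^sup>1 x\<close>.
\<close>

definition base_chain1 :: "('q \<Rightarrow> 'h) \<times> 'q \<Rightarrow> ('h \<Rightarrow>\<^sub>0 int)"
  where "base_chain1 = (\<lambda>(n, q). \<Sum>x\<in>supp n. bar1 H (n x))"

definition base_chain2 ::
  "(('q \<Rightarrow> 'h) \<times> 'q) \<times> (('q \<Rightarrow> 'h) \<times> 'q) \<Rightarrow> ('h \<times> 'h \<Rightarrow>\<^sub>0 int)"
  where "base_chain2 = (\<lambda>((n, q), (m, r)). \<Sum>x\<in>supp n. bar2 H (n x) (m (inv\<^bsub>Q\<^esub> q \<otimes>\<^bsub>Q\<^esub> x)))"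

lemma base_chain1_bar1: "frag_extend base_chain1 (bar1 W w) = base_chain1 w"
  by (auto simp: bar1_def base_chain1_def W_one N_one supp_def)

lemma base_chain2_bar2:
  "w \<in> carrier W \<Longrightarrow> v \<in> carrier W \<Longrightarrow> frag_extend base_chain2 (bar2 W w v) = base_chain2 (w, v)"
  by (cases w) (auto simp: bar2_def base_chain2_def W_iff W_one N_one supp_def intro!: sum.neutral)

lemma base_chain2_closed:
  assumes "w \<in> carrier W" "v \<in> carrier W"
  shows "base_chain2 (w, v) \<in> carrier (bar_chains2 H)"
  using assms by (cases w; cases v)
    (auto simp: W_iff base_chain2_def supp_def intro!: bar_chains2_sum bar2_in_chains N_app)

text \<open>Over a common finite index set this is the boundary formula for
  \<open>[n x|(q m) x]\<close>, summed over \<open>x\<close>. The translation of \<open>m\<close> by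
  \<open>q\<close> does no harm, because \<open>base_chain1\<close> adds up the entries without
  recording their positions.\<close>

lemma bar_boundary2_base_chain2:
  assumes "w \<in> carrier W" "v \<in> carrier W"
  shows "bar_boundary2 H (base_chain2 (w, v)) = base_chain1 v - base_chain1 (w \<otimes>\<^bsub>W\<^esub> v) + base_chain1 w"
proof -
  obtain n q m r where wv: "w = (n, q)" "v = (m, r)" and n: "n \<in> carrier N" and q: "q \<in> carrier Q"
    and m: "m \<in> carrier N" and r: "r \<in> carrier Q"
    using assms by (cases w; cases v) (auto simp: W_iff)
  let ?m = "wreath_act Q q m"
  define S where "S = supp n \<union> supp ?m"
  have m': "?m \<in> carrier N" using q m by (rule act_closed)
  have S: "finite S" "S \<subseteq> carrier Q"
    using n m' by (auto simp: S_def finite_supp dest: subsetD[OF supp_subset])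
  have ext: "(\<Sum>x\<in>supp k. bar1 H (k x)) = (\<Sum>x\<in>S. bar1 H (k x))" if "supp k \<subseteq> S" for k
    using S that by (intro sum.mono_neutral_left) (auto simp: supp_def bar1_def)
  have supp_nm: "supp (n \<otimes>\<^bsub>N\<^esub> ?m) \<subseteq> S" by (auto simp: S_def supp_def N_mult)
  have inj: "inj_on (\<lambda>x. q \<otimes>\<^bsub>Q\<^esub> x) (supp m)"
    using q by (auto intro!: inj_onI simp: supp_def)
  \<comment> \<open>Reindexing by left multiplication with \<open>q\<close> identifies the sums for
    \<open>m\<close> and its translate.\<close>
  have "(\<Sum>x\<in>supp ?m. bar1 H (?m x)) = (\<Sum>x\<in>supp m. bar1 H (m x))"
    unfolding supp_act[OF q] sum.reindex[OF inj]
    by (rule sum.cong) (auto simp: supp_def act_app q Q.m_assoc[symmetric])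
  then have m_sum: "base_chain1 v = (\<Sum>x\<in>S. bar1 H (?m x))"
    using ext[of ?m] by (simp add: wv base_chain1_def S_def)
  have "base_chain2 (w, v) = (\<Sum>x\<in>S. bar2 H (n x) (?m x))"
    unfolding base_chain2_def wv prod.case using S
    by (intro sum.mono_neutral_cong_left) (auto simp: supp_def bar2_def S_def act_app)
  then have "bar_boundary2 H (base_chain2 (w, v))
      = (\<Sum>x\<in>S. bar1 H (?m x) - bar1 H (n x \<otimes>\<^bsub>H\<^esub> ?m x) + bar1 H (n x))"
    using S n m' by (auto simp: bar_boundary2_sum intro!: sum.cong bar_boundary2_bar2 N_app)
  also have "\<dots> = (\<Sum>x\<in>S. bar1 H (?m x)) - (\<Sum>x\<in>S. bar1 H ((n \<otimes>\<^bsub>N\<^esub> ?m) x)) + (\<Sum>x\<in>S. bar1 H (n x))"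
    using S by (simp add: sum.distrib sum_subtractf N_mult subset_iff cong: sum.cong)
  also have "\<dots> = base_chain1 v - base_chain1 (w \<otimes>\<^bsub>W\<^esub> v) + base_chain1 w"
    using ext[OF supp_nm] ext[of n] m_sum by (simp add: wv base_chain1_def W_mult S_def)
  finally show ?thesis .
qed

lemma base_chain2_chain_map:
  assumes "z \<in> carrier (bar_chains2 W)"
  shows "frag_extend base_chain2 z \<in> carrier (bar_chains2 H)"
    and "bar_boundary2 H (frag_extend base_chain2 z) = frag_extend base_chain1 (bar_boundary2 W z)"
proof -
  have "frag_extend base_chain2 z \<in> carrier (bar_chains2 H) \<and>
    bar_boundary2 H (frag_extend base_chain2 z) = frag_extend base_chain1 (bar_boundary2 W z)"
    using assms
  proof (induction z rule: bar_chains2_induct)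
    case zero
    then show ?case by (simp add: carrier_bar_chains2 bar_boundary2_def)
  next
    case (bar2 w v)
    then show ?case
      by (simp add: base_chain2_bar2 base_chain2_closed bar_boundary2_base_chain2
          bar_boundary2_bar2[OF group_W] frag_extend_add frag_extend_diff base_chain1_bar1)
  qed (simp add: frag_extend_diff bar_chains2_diff bar_boundary2_diff)
  then show "frag_extend base_chain2 z \<in> carrier (bar_chains2 H)"
    and "bar_boundary2 H (frag_extend base_chain2 z) = frag_extend base_chain1 (bar_boundary2 W z)"
    by auto
qed

text \<open>The symbols \<open>[w|v]\<close>, taken modulo cycles of trivial class, form a cocycle
  to which \<open>cocycle_decomposition\<close> applies. The resulting identity extends linearly to
  all chains, and on cycles its coboundary term disappears.\<close>

lemma bogomolov_class_decomposition:
  assumes z: "z \<in> carrier (bar_cycles2 W)"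
  shows "frag_extend base_chain2 z \<in> carrier (bar_cycles2 H)"
    and "bogomolov_class W z =
      bogomolov_class W (bar_map2 W (wreath_embed H Q) (frag_extend base_chain2 z))
      \<otimes>\<^bsub>bogomolov_multiplier W\<^esub> bogomolov_class W (bar_map2 W section_map (bar_map2 Q wreath_proj z))"
proof -
  let ?\<iota> = "wreath_embed H Q" and ?P = "frag_extend base_chain2" and ?B = "bogomolov_multiplier W"
  show Pz: "?P z \<in> carrier (bar_cycles2 H)"
    using z base_chain2_chain_map[of z] by (simp add: carrier_bar_cycles2)
  interpret C: comm_group "bar_chains2 W" by (rule comm_group_bar_chains2)
  interpret k: group_hom "bar_cycles2 W" ?B "bogomolov_class W"
    by (rule group_hom_bogomolov_class[OF group_W])
  define K where "K = kernel (bar_cycles2 W) ?B (bogomolov_class W)"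
  have K_iff: "u \<in> K \<longleftrightarrow> u \<in> carrier (bar_cycles2 W) \<and> bogomolov_class W u = \<one>\<^bsub>?B\<^esub>" for u
    by (simp add: K_def kernel_def)
  have "subgroup K (bar_cycles2 W)" unfolding K_def by (rule k.subgroup_kernel)
  then have "subgroup K ((bar_chains2 W)\<lparr>carrier := carrier (bar_cycles2 W)\<rparr>)"
    by (simp add: bar_cycles2_def)
  then have K: "subgroup K (bar_chains2 W)"
    using C.incl_subgroup[OF subgroup_bar_cycles2[OF group_W]] by simp
  then interpret K: normal K "bar_chains2 W" by (rule C.subgroup_imp_normal)
  have K_boundaries: "u \<in> K" if "u \<in> bar_boundaries2 W" for u
    using that bar_boundaries2_cycles[OF group_W] bogomolov_class_boundary_eq_one[OF group_W]
    by (auto simp: K_iff)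
  have K_commuting: "bar2 W w v - bar2 W v w \<in> K"
    if "w \<in> carrier W" "v \<in> carrier W" "w \<otimes>\<^bsub>W\<^esub> v = v \<otimes>\<^bsub>W\<^esub> w" for w v
    using bogomolov_class_commutator_eq_one[OF group_W that] by (simp add: K_iff)
  \<comment> \<open>\<open>K\<close> consists of cycles, but a single symbol need not be a cycle, so
    the quotient is formed from the whole chain group.\<close>
  define X where "X = bar_chains2 W Mod K"
  interpret X: comm_group X unfolding X_def by (rule C.abelian_FactGroup[OF K])
  define \<kappa> where "\<kappa> = (\<lambda>u. K #>\<^bsub>bar_chains2 W\<^esub> u)"
  have "\<kappa> \<in> hom (bar_chains2 W) X" unfolding X_def \<kappa>_def by (rule K.r_coset_hom_Mod)
  then interpret \<kappa>: group_hom "bar_chains2 W" X \<kappa> by unfold_locales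
  have add: "\<kappa> (u + v) = \<kappa> u \<otimes>\<^bsub>X\<^esub> \<kappa> v"
    if "u \<in> carrier (bar_chains2 W)" "v \<in> carrier (bar_chains2 W)" for u v
    using \<kappa>.hom_mult[OF that] by simp
  have plus: "u + v \<in> carrier (bar_chains2 W)"
    if "u \<in> carrier (bar_chains2 W)" "v \<in> carrier (bar_chains2 W)" for u v
    using C.m_closed[OF that] by simp
  have eq_iff: "\<kappa> u = \<kappa> v \<longleftrightarrow> u - v \<in> K"
    if uv: "u \<in> carrier (bar_chains2 W)" "v \<in> carrier (bar_chains2 W)" for u v
  proof -
    have d: "u - v \<in> carrier (bar_chains2 W)" using uv by (rule bar_chains2_diff)
    have "\<kappa> u = \<kappa> (u - v) \<otimes>\<^bsub>X\<^esub> \<kappa> v" using add[OF d uv(2)] by simp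
    then have "\<kappa> u = \<kappa> v \<longleftrightarrow> \<kappa> (u - v) = \<one>\<^bsub>X\<^esub>" using d uv by simp
    also have "\<dots> \<longleftrightarrow> u - v \<in> K"
      using C.coset_join1[OF _ d K] C.coset_join2[OF d K]
      by (auto simp: \<kappa>_def X_def)
    finally show ?thesis .
  qed
  have surj: "\<exists>u\<in>carrier (bar_chains2 W). \<kappa> u = x" if "x \<in> carrier X" for x
    using that by (auto simp: X_def \<kappa>_def carrier_FactGroup)
  \<comment> \<open>The tautological cocycle: its cocycle identity holds because \<open>K\<close>
    contains the boundaries, and its symmetry on commuting pairs holds by
    \<open>K_commuting\<close>.\<close>
  define c where "c = (\<lambda>w v. \<kappa> (bar2 W w v))"
  have cocyc: "normalized_cocycle X W c"
  proof (intro normalized_cocycle.intro normalized_cocycle_axioms.intro)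
    show "comm_group X" "group W" by (rule X.comm_group_axioms, rule group_W)
    fix x y w assume xyw: "x \<in> carrier W" "y \<in> carrier W" "w \<in> carrier W"
    have "bar2 W y w + bar2 W x (y \<otimes>\<^bsub>W\<^esub> w) - (bar2 W x y + bar2 W (x \<otimes>\<^bsub>W\<^esub> y) w) = bar3_boundary W x y w"
      by (simp add: bar3_boundary_def)
    then have "\<kappa> (bar2 W y w + bar2 W x (y \<otimes>\<^bsub>W\<^esub> w)) = \<kappa> (bar2 W x y + bar2 W (x \<otimes>\<^bsub>W\<^esub> y) w)"
      using xyw by (subst eq_iff)
        (auto intro!: plus bar2_in_chains K_boundaries bar3_boundary_in_boundaries[OF group_W])
    then show "c x y \<otimes>\<^bsub>X\<^esub> c (x \<otimes>\<^bsub>W\<^esub> y) w = c y w \<otimes>\<^bsub>X\<^esub> c x (y \<otimes>\<^bsub>W\<^esub> w)"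
      using xyw by (simp add: c_def add bar2_in_chains)
  next
    fix x assume "x \<in> carrier W"
    have "\<kappa> 0 = \<one>\<^bsub>X\<^esub>" using \<kappa>.hom_one by simp
    then show "c \<one>\<^bsub>W\<^esub> x = \<one>\<^bsub>X\<^esub>" "c x \<one>\<^bsub>W\<^esub> = \<one>\<^bsub>X\<^esub>"
      by (simp_all add: c_def bar2_def)
  qed (simp add: c_def bar2_in_chains)
  interpret c: normalized_cocycle X W c by (rule cocyc)
  have c_comm: "c w v = c v w" if "w \<in> carrier W" "v \<in> carrier W" "w \<otimes>\<^bsub>W\<^esub> v = v \<otimes>\<^bsub>W\<^esub> w" for w v
    using that by (simp add: c_def eq_iff bar2_in_chains K_commuting)
  obtain \<beta> where \<beta>_closed: "\<And>w. w \<in> carrier W \<Longrightarrow> \<beta> w \<in> carrier X"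
    and \<beta>: "\<And>n q m r. n \<in> carrier N \<Longrightarrow> q \<in> carrier Q \<Longrightarrow> m \<in> carrier N \<Longrightarrow> r \<in> carrier Q \<Longrightarrow>
      \<beta> (n, q) \<otimes>\<^bsub>X\<^esub> \<beta> (m, r) \<otimes>\<^bsub>X\<^esub> c (n, q) (m, r) = \<beta> ((n, q) \<otimes>\<^bsub>W\<^esub> (m, r)) \<otimes>\<^bsub>X\<^esub>
        (finprod X (\<lambda>x. c (?\<iota> (n x)) (?\<iota> (m (inv\<^bsub>Q\<^esub> q \<otimes>\<^bsub>Q\<^esub> x)))) (supp n)
          \<otimes>\<^bsub>X\<^esub> c (section_map q) (section_map r))"
    using cocycle_decomposition[OF cocyc c_comm] by blast
  \<comment> \<open>Evaluating the identity for \<open>\<beta>\<close> at two identity elements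
    normalizes it. The chain representatives \<open>T\<close> can then vanish at the identity, which
    makes their linear extension compatible with \<open>bar1\<close>.\<close>
  have \<beta>_one: "\<beta> \<one>\<^bsub>W\<^esub> = \<one>\<^bsub>X\<^esub>"
  proof -
    have "supp \<one>\<^bsub>N\<^esub> = {}" by (auto simp: supp_def N_one)
    moreover have "section_map \<one>\<^bsub>Q\<^esub> = \<one>\<^bsub>W\<^esub>" by (simp add: section_map_def W_one)
    ultimately have "\<beta> \<one>\<^bsub>W\<^esub> \<otimes>\<^bsub>X\<^esub> \<beta> \<one>\<^bsub>W\<^esub> = \<beta> \<one>\<^bsub>W\<^esub>"
      using \<beta>[of "\<one>\<^bsub>N\<^esub>" "\<one>\<^bsub>Q\<^esub>" "\<one>\<^bsub>N\<^esub>" "\<one>\<^bsub>Q\<^esub>"] \<beta>_closed[of "\<one>\<^bsub>W\<^esub>"]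
      by (simp add: W_one[symmetric])
    then show ?thesis using \<beta>_closed[of "\<one>\<^bsub>W\<^esub>"] by simp
  qed
  \<comment> \<open>Each value of \<open>\<beta>\<close> is a coset, so a representing chain is
    chosen; the coboundary of \<open>\<beta>\<close> is then represented by
    \<open>frag_extend T\<close> applied to boundaries.\<close>
  have "\<exists>u. u \<in> carrier (bar_chains2 W) \<and> \<kappa> u = \<beta> w \<and> (w = \<one>\<^bsub>W\<^esub> \<longrightarrow> u = 0)" if "w \<in> carrier W" for w
    using surj[OF \<beta>_closed[OF that]] \<kappa>.hom_one \<beta>_one C.one_closed by (cases "w = \<one>\<^bsub>W\<^esub>") auto
  then obtain T where T: "\<And>w. w \<in> carrier W \<Longrightarrow> T w \<in> carrier (bar_chains2 W)"
    and \<kappa>T: "\<And>w. w \<in> carrier W \<Longrightarrow> \<kappa> (T w) = \<beta> w" and T_one: "T \<one>\<^bsub>W\<^esub> = 0"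
    by (metis W.one_closed)
  have T_bar1: "frag_extend T (bar1 W w) = T w" for w
    by (simp add: bar1_def T_one)
  have \<iota>: "?\<iota> h \<in> carrier W" if "h \<in> carrier H" for h
    using that wreath_embed_hom by (rule hom_in_carrier[rotated])
  have \<kappa>_sum: "(\<Sum>x\<in>S. f x) \<in> carrier (bar_chains2 W) \<and> \<kappa> (\<Sum>x\<in>S. f x) = finprod X (\<lambda>x. \<kappa> (f x)) S"
    if "finite S" "\<And>x. x \<in> S \<Longrightarrow> f x \<in> carrier (bar_chains2 W)" for S :: "'q set" and f
    using that
  proof (induction S rule: finite_induct)
    case empty
    then show ?case using \<kappa>.hom_one C.one_closed by simp
  next
    case (insert x S)
    then have "finprod X (\<lambda>x. \<kappa> (f x)) (insert x S) = \<kappa> (f x) \<otimes>\<^bsub>X\<^esub> finprod X (\<lambda>x. \<kappa> (f x)) S"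
      by (intro X.finprod_insert) auto
    then show ?case using insert by (simp add: add plus)
  qed
  \<comment> \<open>\<open>D u\<close> is the error in the decomposition of a chain, with the
    coboundary term included. It is additive in \<open>u\<close>, so membership in \<open>K\<close>
    reduces to symbols.\<close>
  define D where "D = (\<lambda>u. u + frag_extend T (bar_boundary2 W u)
      - (bar_map2 W ?\<iota> (?P u) + bar_map2 W section_map (bar_map2 Q wreath_proj u)))"
  have "D z \<in> K"
    using z[unfolded carrier_bar_cycles2, THEN conjunct1]
  proof (induction z rule: bar_chains2_induct)
    case zero
    have "D 0 = 0" by (simp add: D_def bar_boundary2_def bar_map2_def)
    then show ?case using K.one_closed by simp
  next
    case (diff u v)
    have "D (u - v) = D u - D v"
      by (simp add: D_def bar_boundary2_diff bar_map2_diff frag_extend_diff algebra_simps)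
    moreover have "D u - D v \<in> K"
    proof -
      have Du: "D u \<in> carrier (bar_chains2 W)" "D v \<in> carrier (bar_chains2 W)"
        using diff by (auto intro: K.mem_carrier)
      have "0 \<in> K" using K.one_closed by simp
      then have "\<kappa> (D u) = \<kappa> 0" "\<kappa> (D v) = \<kappa> 0"
        using diff Du K.mem_carrier[OF \<open>0 \<in> K\<close>] by (simp_all add: eq_iff)
      then show ?thesis using Du by (simp add: eq_iff[symmetric])
    qed
    ultimately show ?case by simp
  next
    case (bar2 w v)
    then obtain n q m r where wv: "w = (n, q)" "v = (m, r)" and n: "n \<in> carrier N" and q: "q \<in> carrier Q"
      and m: "m \<in> carrier N" and r: "r \<in> carrier Q"
      by (cases w; cases v) (auto simp: W_iff)
    let ?S = "\<Sum>x\<in>supp n. bar2 W (?\<iota> (n x)) (?\<iota> (m (inv\<^bsub>Q\<^esub> q \<otimes>\<^bsub>Q\<^esub> x)))"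
    let ?\<sigma> = "bar2 W (section_map q) (section_map r)"
    have S: "?S \<in> carrier (bar_chains2 W)"
      "\<kappa> ?S = finprod X (\<lambda>x. c (?\<iota> (n x)) (?\<iota> (m (inv\<^bsub>Q\<^esub> q \<otimes>\<^bsub>Q\<^esub> x)))) (supp n)"
      using \<kappa>_sum[OF finite_supp[OF n], of "\<lambda>x. bar2 W (?\<iota> (n x)) (?\<iota> (m (inv\<^bsub>Q\<^esub> q \<otimes>\<^bsub>Q\<^esub> x)))"]
        n m q by (auto simp: c_def supp_def intro!: bar2_in_chains \<iota> N_app)
    have \<sigma>: "?\<sigma> \<in> carrier (bar_chains2 W)"
      using q r by (intro bar2_in_chains) (simp_all add: section_map_def W_iff)
    have wv_in: "bar2 W w v \<in> carrier (bar_chains2 W)" "w \<otimes>\<^bsub>W\<^esub> v \<in> carrier W"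
      using bar2 by (simp_all add: bar2_in_chains)
    note mem = S(1) \<sigma> wv_in(1) T[OF bar2(1)] T[OF bar2(2)] T[OF wv_in(2)] plus
    \<comment> \<open>This is the identity for \<open>\<beta>\<close> expressed through representing
      chains; by \<open>eq_iff\<close> the two sides differ by an element of
      \<open>K\<close>.\<close>
    have "\<kappa> (T w + T v + bar2 W w v) = \<kappa> (T (w \<otimes>\<^bsub>W\<^esub> v) + (?S + ?\<sigma>))"
      using \<beta>[OF n q m r] bar2 wv_in(2) by (simp add: add mem \<kappa>T S(2)) (simp add: c_def wv)
    then have "T w + T v + bar2 W w v - (T (w \<otimes>\<^bsub>W\<^esub> v) + (?S + ?\<sigma>)) \<in> K"
      by (simp add: eq_iff mem)
    moreover have "bar_map2 W ?\<iota> (?P (bar2 W w v)) = ?S"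
      using bar2 finite_supp[OF n]
      by (simp add: base_chain2_bar2) (simp add: wv base_chain2_def bar_map2_sum
          bar_map2_bar2[OF H.group_axioms group_W wreath_embed_hom])
    moreover have "bar_map2 W section_map (bar_map2 Q wreath_proj (bar2 W w v)) = ?\<sigma>"
      by (simp add: bar_map2_bar2[OF group_W Q.group_axioms wreath_proj_hom]
          bar_map2_bar2[OF Q.group_axioms group_W section_hom])
        (simp add: wreath_proj_def wv)
    moreover have "frag_extend T (bar_boundary2 W (bar2 W w v)) = T v - T (w \<otimes>\<^bsub>W\<^esub> v) + T w"
      using bar2 by (simp add: bar_boundary2_bar2[OF group_W] frag_extend_add frag_extend_diff T_bar1)
    moreover have "bar2 W w v + (T v - T (w \<otimes>\<^bsub>W\<^esub> v) + T w) - (?S + ?\<sigma>)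
        = T w + T v + bar2 W w v - (T (w \<otimes>\<^bsub>W\<^esub> v) + (?S + ?\<sigma>))"
      by (simp add: algebra_simps)
    ultimately show ?case by (simp only: D_def)
  qed
  \<comment> \<open>The boundary of \<open>z\<close> is zero, so the term with \<open>T\<close>
    drops out.\<close>
  moreover have "D z = z - (bar_map2 W ?\<iota> (?P z) + bar_map2 W section_map (bar_map2 Q wreath_proj z))"
    using z by (simp add: D_def carrier_bar_cycles2)
  ultimately have D: "D z \<in> carrier (bar_cycles2 W)" "bogomolov_class W (D z) = \<one>\<^bsub>?B\<^esub>"
    "z = D z + (bar_map2 W ?\<iota> (?P z) + bar_map2 W section_map (bar_map2 Q wreath_proj z))"
    by (simp_all add: K_iff)
  have cyc: "bar_map2 W ?\<iota> (?P z) \<in> carrier (bar_cycles2 W)"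
    "bar_map2 W section_map (bar_map2 Q wreath_proj z) \<in> carrier (bar_cycles2 W)"
    using Pz z by (auto intro!: bar_map2_in_cycles[OF _ _ wreath_embed_hom]
        bar_map2_in_cycles[OF _ _ section_hom] bar_map2_in_cycles[OF _ _ wreath_proj_hom]
        group_W H.group_axioms Q.group_axioms)
  have "bogomolov_class W z = bogomolov_class W
      (D z \<otimes>\<^bsub>bar_cycles2 W\<^esub> (bar_map2 W ?\<iota> (?P z) \<otimes>\<^bsub>bar_cycles2 W\<^esub> bar_map2 W section_map (bar_map2 Q wreath_proj z)))"
    using D(3) by simp
  also have "\<dots> = bogomolov_class W (bar_map2 W ?\<iota> (?P z))
      \<otimes>\<^bsub>?B\<^esub> bogomolov_class W (bar_map2 W section_map (bar_map2 Q wreath_proj z))"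
    using D(1,2) cyc by (simp only: k.hom_mult k.G.m_closed k.hom_closed k.H.m_closed k.H.l_one)
  finally show "bogomolov_class W z = bogomolov_class W (bar_map2 W ?\<iota> (?P z))
      \<otimes>\<^bsub>?B\<^esub> bogomolov_class W (bar_map2 W section_map (bar_map2 Q wreath_proj z))" .
qed

text \<open>Functoriality applied to \<open>section_map\<close> splits the projection and gives
  surjectivity. For exactness in the middle, the decomposition writes a class \<open>x\<close> as a
  class from \<open>H\<close> times \<open>?s (?g x)\<close>, and the second factor is trivial when
  \<open>x\<close> lies in the kernel.\<close>

lemma split_right_exact_bogomolov_multiplier:
  "split_right_exact (bogomolov_multiplier H) (bogomolov_multiplier W) (bogomolov_multiplier Q)
    (bogomolov_multiplier_map W (wreath_embed H Q)) (bogomolov_multiplier_map Q wreath_proj)"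
proof -
  let ?f = "bogomolov_multiplier_map W (wreath_embed H Q)"
  let ?g = "bogomolov_multiplier_map Q wreath_proj"
  let ?s = "bogomolov_multiplier_map W section_map"
  note groups = H.group_axioms Q.group_axioms group_W
  interpret f: group_hom "bogomolov_multiplier H" "bogomolov_multiplier W" ?f
    by (rule group_hom_bogomolov_multiplier_map[OF groups(1,3) wreath_embed_hom])
  interpret g: group_hom "bogomolov_multiplier W" "bogomolov_multiplier Q" ?g
    by (rule group_hom_bogomolov_multiplier_map[OF groups(3,2) wreath_proj_hom])
  interpret s: group_hom "bogomolov_multiplier Q" "bogomolov_multiplier W" ?s
    by (rule group_hom_bogomolov_multiplier_map[OF groups(2,3) section_hom])
  note f_class = bogomolov_multiplier_map_class[OF groups(1,3) wreath_embed_hom]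
  note g_class = bogomolov_multiplier_map_class[OF groups(3,2) wreath_proj_hom]
  note s_class = bogomolov_multiplier_map_class[OF groups(2,3) section_hom]
  have f_cyc: "bar_map2 W (wreath_embed H Q) z \<in> carrier (bar_cycles2 W)"
    if "z \<in> carrier (bar_cycles2 H)" for z
    using that by (rule bar_map2_in_cycles[OF groups(1,3) wreath_embed_hom])
  have g_cyc: "bar_map2 Q wreath_proj z \<in> carrier (bar_cycles2 Q)"
    if "z \<in> carrier (bar_cycles2 W)" for z
    using that by (rule bar_map2_in_cycles[OF groups(3,2) wreath_proj_hom])
  have s_cyc: "bar_map2 W section_map z \<in> carrier (bar_cycles2 W)"
    if "z \<in> carrier (bar_cycles2 Q)" for z
    using that by (rule bar_map2_in_cycles[OF groups(2,3) section_hom])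
  have gs: "?g (?s x) = x" if x: "x \<in> carrier (bogomolov_multiplier Q)" for x
  proof -
    obtain z where z: "z \<in> carrier (bar_cycles2 Q)" "x = bogomolov_class Q z"
      using x unfolding carrier_bogomolov_multiplier by blast
    have "z \<in> carrier (bar_chains2 Q)" using z by (simp add: carrier_bar_cycles2)
    moreover have "wreath_proj \<circ> section_map = (\<lambda>x. x)"
      by (simp add: fun_eq_iff wreath_proj_def section_map_def)
    ultimately have "bar_map2 Q wreath_proj (bar_map2 W section_map z) = bar_map2 Q (\<lambda>x. x) z"
      by (simp only: bar_map2_compose[OF groups(2,3,2) section_hom wreath_proj_hom])
    then show ?thesis
      using z \<open>z \<in> carrier (bar_chains2 Q)\<close> by (simp add: s_class g_class s_cyc bar_map2_id)
  qed
  have gf: "?g (?f x) = \<one>\<^bsub>bogomolov_multiplier Q\<^esub>" if x: "x \<in> carrier (bogomolov_multiplier H)" for x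
  proof -
    obtain z where z: "z \<in> carrier (bar_cycles2 H)" "x = bogomolov_class H z"
      using x unfolding carrier_bogomolov_multiplier by blast
    then have "bar_map2 Q wreath_proj (bar_map2 W (wreath_embed H Q) z)
        = bar_map2 Q (wreath_proj \<circ> wreath_embed H Q) z"
      by (intro bar_map2_compose[OF groups(1,3,2) wreath_embed_hom wreath_proj_hom]) (simp add: carrier_bar_cycles2)
    \<comment> \<open>The projection is constantly the identity on the embedded copy of
      \<open>H\<close>, so every symbol becomes degenerate.\<close>
    also have "\<dots> = 0"
      by (auto simp: bar_map2_def comp_def wreath_proj_def wreath_embed_eq bar2_def intro!: frag_extend_eq_0)
    finally show ?thesis
      using z group_hom.hom_one[OF group_hom_bogomolov_class[OF groups(2)]]
      by (simp add: f_class g_class f_cyc)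
  qed
  have ker: "x \<in> ?f ` carrier (bogomolov_multiplier H)"
    if x: "x \<in> carrier (bogomolov_multiplier W)" and gx: "?g x = \<one>\<^bsub>bogomolov_multiplier Q\<^esub>" for x
  proof -
    obtain z where z: "z \<in> carrier (bar_cycles2 W)" "x = bogomolov_class W z"
      using x unfolding carrier_bogomolov_multiplier by blast
    note dec = bogomolov_class_decomposition[OF z(1)]
    have "bogomolov_class W (bar_map2 W section_map (bar_map2 Q wreath_proj z)) = ?s (?g x)"
      using z by (simp add: s_class g_class g_cyc)
    also have "\<dots> = \<one>\<^bsub>bogomolov_multiplier W\<^esub>" using gx by simp
    finally have "x = ?f (bogomolov_class H (frag_extend base_chain2 z))"
      using dec z(2) f_class[OF dec(1)] f_cyc[OF dec(1)]
      by (simp add: carrier_bogomolov_multiplier)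
    then show ?thesis using dec(1) by (simp add: carrier_bogomolov_multiplier)
  qed
  have "?f ` carrier (bogomolov_multiplier H) = kernel (bogomolov_multiplier W) (bogomolov_multiplier Q) ?g"
    using gf ker f.hom_closed by (auto simp: kernel_def)
  moreover have "?g ` carrier (bogomolov_multiplier W) = carrier (bogomolov_multiplier Q)"
  proof (intro equalityI subsetI)
    fix x assume x: "x \<in> carrier (bogomolov_multiplier Q)"
    then show "x \<in> ?g ` carrier (bogomolov_multiplier W)"
      by (intro image_eqI[where x = "?s x"]) (simp_all add: gs)
  qed auto
  ultimately show ?thesis
    unfolding split_right_exact_def
    using f.group_hom_axioms g.group_hom_axioms s.homh gs by blast
qed

end

theorem theorem6p11:
  fixes H :: "('h, 'c) monoid_scheme" and Q :: "('q, 'd) monoid_scheme"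
  assumes "group H" and "group Q"
  shows "split_right_exact
      (bogomolov_multiplier H) (bogomolov_multiplier (wreath_product H Q)) (bogomolov_multiplier Q)
      (bogomolov_multiplier_map (wreath_product H Q) (wreath_embed H Q))
      (bogomolov_multiplier_map Q wreath_proj)
    \<and> bogomolov_multiplier (wreath_product H Q) \<cong>
      bogomolov_multiplier Q \<times>\<times>
        (bogomolov_multiplier H Mod
          kernel (bogomolov_multiplier H) (bogomolov_multiplier (wreath_product H Q))
            (bogomolov_multiplier_map (wreath_product H Q) (wreath_embed H Q)))"
proof -
  interpret wreath_groups H Q using assms by (simp add: wreath_groups_def)
  show ?thesis
    using split_right_exact_bogomolov_multiplier
      split_right_exact_iso[OF split_right_exact_bogomolov_multiplier comm_group_bogomolov_multiplier[OF group_W]]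
    by blast
qed

end
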